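(* There exist an absolute constant $C$ and a real sequence $(\eta_n)$ with $\eta_n\to 0$ as $n\to\infty$ such that, for all sufficiently large $n$, $$\exp\Big(\big(\tfrac16-\eta_n\big)n^{3/2}\Big)\le \mathrm{Vol}(\mathcal{M}_n)\le \exp\big(Cn^{3/2}\big).$$
   Context: For an integer $n\ge 2$ write $[n]=\{1,\dots,n\}$ and let $\binom{[n]}{2}$ be the set of unordered pairs of distinct elements of $[n]$. The metric polytope $\mathcal{M}_n\subseteq\mathbb{R}^{\binom{n}{2}}$ is the set of all arrays $(d_{ij})$ indexed by $\{i,j\}\in\binom{[n]}{2}$ (with $d_{ij}=d_{ji}$) such that $0<d_{ij}\le 2$ for all $\{i,j\}$ and $d_{ij}\le d_{ik}+d_{kj}$ for all distinct $i,j,k\in[n]$. $\mathrm{Vol}$ denotes Lebesgue measure in $\mathbb{R}^{\binom{n}{2}}$. *)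

theory Defs
  imports "HOL-Analysis.Analysis" "HOL-Library.Ramsey"
begin

(* Coordinates are indexed by the two-element subsets of {1..n}, so d_ij is d {i,j} and the
   symmetry d_ij = d_ji is built in. *)
definition metric_polytope :: "nat \<Rightarrow> (nat set \<Rightarrow> real) set" where
  "metric_polytope n =
    {d \<in> nsets {1..n} 2 \<rightarrow>\<^sub>E UNIV.
       (\<forall>e \<in> nsets {1..n} 2. 0 < d e \<and> d e \<le> 2) \<and>
       (\<forall>i \<in> {1..n}. \<forall>j \<in> {1..n}. \<forall>k \<in> {1..n}. i \<noteq> j \<longrightarrow> i \<noteq> k \<longrightarrow> j \<noteq> k \<longrightarrow>
          d {i, j} \<le> d {i, k} + d {k, j})}"

(* Lebesgue measure on the real vectors with coordinates in nsets {1..n} 2; the lemmas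
   below show that the polytope is measurable of finite volume, so "measure" does not
   fall back on its default value 0. *)
definition pair_lebesgue :: "nat \<Rightarrow> (nat set \<Rightarrow> real) measure" where
  "pair_lebesgue n = Pi\<^sub>M (nsets {1..n} 2) (\<lambda>_. lborel)"

lemma finite_pairs: "finite (nsets {1..n::nat} 2)"
  by (simp add: finite_imp_finite_nsets)

lemma metric_polytope_measurable: "metric_polytope n \<in> sets (pair_lebesgue n)"
proof -
  let ?P = "nsets {1..n} 2"
  let ?M = "Pi\<^sub>M ?P (\<lambda>_. lborel) :: (nat set \<Rightarrow> real) measure"
  have c: "(\<lambda>d. d e) \<in> borel_measurable ?M" if "e \<in> ?P" for e
    using measurable_component_singleton[OF that, of "\<lambda>_. lborel :: real measure"] by simp
  have sp: "space ?M = ?P \<rightarrow>\<^sub>E UNIV"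
    by (simp add: space_PiM)
  have a: "{d \<in> space ?M. \<forall>e \<in> ?P. 0 < d e \<and> d e \<le> 2} \<in> sets ?M"
    by (intro sets.sets_Collect_finite_All sets.sets_Collect_conj
        borel_measurable_less[OF borel_measurable_const c]
        borel_measurable_le[OF c borel_measurable_const] finite_pairs)
  have b: "{d \<in> space ?M. i \<noteq> j \<longrightarrow> i \<noteq> k \<longrightarrow> j \<noteq> k \<longrightarrow> d {i, j} \<le> d {i, k} + d {k, j}} \<in> sets ?M"
    if "i \<in> {1..n}" "j \<in> {1..n}" "k \<in> {1..n}" for i j k
  proof (cases "i \<noteq> j \<and> i \<noteq> k \<and> j \<noteq> k")
    case True
    then have "{d \<in> space ?M. d {i, j} \<le> d {i, k} + d {k, j}} \<in> sets ?M"
      using that by (intro borel_measurable_le borel_measurable_add c) simp_all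
    with True show ?thesis by simp
  next
    case False
    then have "{d \<in> space ?M. i \<noteq> j \<longrightarrow> i \<noteq> k \<longrightarrow> j \<noteq> k \<longrightarrow> d {i, j} \<le> d {i, k} + d {k, j}} = space ?M"
      by blast
    then show ?thesis by simp
  qed
  have "{d \<in> space ?M. \<forall>i \<in> {1..n}. \<forall>j \<in> {1..n}. \<forall>k \<in> {1..n}. i \<noteq> j \<longrightarrow> i \<noteq> k \<longrightarrow> j \<noteq> k \<longrightarrow>
          d {i, j} \<le> d {i, k} + d {k, j}} \<in> sets ?M"
    by (intro sets.sets_Collect_finite_All b finite_atLeastAtMost)
  from sets.sets_Collect_conj[OF this a] show ?thesis
    unfolding metric_polytope_def pair_lebesgue_def sp .
qed

lemma metric_polytope_finite: "emeasure (pair_lebesgue n) (metric_polytope n) < \<infinity>"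
proof -
  interpret product_sigma_finite "\<lambda>_::nat set. lborel :: real measure" ..
  let ?P = "nsets {1..n} 2"
  let ?B = "?P \<rightarrow>\<^sub>E {0..2::real}"
  have B: "?B \<in> sets (pair_lebesgue n)"
    unfolding pair_lebesgue_def using finite_pairs[of n] by (intro sets_PiM_I_finite) auto
  have "metric_polytope n \<subseteq> ?B"
    by (fastforce simp: metric_polytope_def PiE_iff extensional_def)
  then have "emeasure (pair_lebesgue n) (metric_polytope n) \<le> emeasure (pair_lebesgue n) ?B"
    using B by (rule emeasure_mono)
  also have "\<dots> = (\<Prod>e\<in>?P. emeasure lborel {0..2::real})"
    unfolding pair_lebesgue_def using finite_pairs[of n] by (intro emeasure_PiM) auto
  also have "\<dots> < \<infinity>"
    by (simp add: power_less_top_ennreal)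
  finally show ?thesis .
qed

end

theory Submission
  imports Defs "HOL-Real_Asymp.Real_Asymp"
begin

text \<open>
  Upper bound. Rounding distances up to multiples of \<open>1 / N\<close> with \<open>N = n\<close> reduces the claim to counting
  integer metrics \<open>w\<close>, and hence to bounding the entropy of a uniformly random one. If three edges of a
  triangle were independent with values in \<open>(0, 2]\<close> and never violated the triangle inequality, their
  entropies would add up to at most \<open>0\<close> (relative to \<open>ln N\<close> each): with supports in \<open>[a_i, b_i]\<close> one has
  \<open>b_1 + b_2 + b_3 \<le> 2 (a_1 + a_2 + a_3)\<close>, so the lengths have mean at most 1. Quantitatively, an entropy
  excess \<open>\<epsilon>\<close> forces the independent coupling to violate the inequality with probability of order
  \<open>\<epsilon>^3\<close>, and therefore forces the true joint law to have mutual information of order \<open>\<epsilon>^3\<close>. Let \<open>\<alpha>_k\<close> be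
  the excess entropy of an edge given all edges that meet \<open>k\<close> other vertices. By submodularity the conditional
  mutual information of a triangle is at most \<open>2 (\<alpha>_k - \<alpha>_(k+1))\<close>, so \<open>\<alpha>_k^3\<close> is at most a constant times
  \<open>\<alpha>_k - \<alpha>_(k+1)\<close>, whence \<open>\<alpha>_k = O(1 / sqrt k)\<close>; summing over the edges gives \<open>O(n powr (3/2))\<close>.

  Lower bound. Choose all distances independently and uniformly from \<open>(1 - \<delta>, 2]\<close> with
  \<open>\<delta> = 1 / (2 * sqrt n)\<close>. A triangle is violated with probability about \<open>4 \<delta>^3\<close> and shares an edge with
  fewer than \<open>3 n\<close> others, so by the local lemma no triangle is violated with probability at least about
  \<open>exp (- 4 \<delta>^3 * n^3 / 6)\<close>. Together with the volume \<open>(1 + \<delta>)\<close> to the power \<open>n choose 2\<close> this yields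
  the exponent \<open>(1/4 - 1/12) n powr (3/2)\<close>.
\<close>

subsection \<open>Entropy of a single edge\<close>

definition shannon :: "'a set \<Rightarrow> ('a \<Rightarrow> real) \<Rightarrow> real" where
  "shannon A P = - (\<Sum>x\<in>A. P x * ln (P x))"

text \<open>Gibbs' inequality against the unnormalised weight \<open>g\<close>, from
  \<open>ln t \<le> t - 1\<close> at \<open>t = g x / (c * P x)\<close>. The tangent of
  \<open>ln\<close> at \<open>c\<close> replaces \<open>ln (sum g A)\<close>, so the bound is linear
  in \<open>sum g A\<close> and the bounds of three edges can be added.\<close>

lemma shannon_le_cross_entropy:
  fixes P g :: "'a \<Rightarrow> real"
  assumes "finite A" and P: "\<And>x. x \<in> A \<Longrightarrow> 0 \<le> P x" "sum P A = 1"
    and g: "\<And>x. x \<in> A \<Longrightarrow> 0 < g x" and c: "c > 0"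
  shows "shannon A P \<le> (\<Sum>x\<in>A. P x * - ln (g x)) + sum g A / c - 1 + ln c"
proof -
  have "P x * ln (g x) - P x * ln c - P x * ln (P x) \<le> g x / c - P x" if "x \<in> A" for x
  proof (cases "P x = 0")
    case True
    then show ?thesis using g[OF that] c by simp
  next
    case False
    with P(1)[OF that] have p: "P x > 0" by simp
    have "ln (g x / (c * P x)) \<le> g x / (c * P x) - 1"
      using p g[OF that] c by (intro ln_le_minus_one) simp
    also have "ln (g x / (c * P x)) = ln (g x) - ln c - ln (P x)"
      using p g[OF that] c by (simp add: ln_div ln_mult)
    finally have "P x * (ln (g x) - ln c - ln (P x)) \<le> P x * (g x / (c * P x) - 1)"
      using p by (intro mult_left_mono) auto
    also have "\<dots> = g x / c - P x" using p c by (simp add: field_simps)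
    finally show ?thesis by (simp add: algebra_simps)
  qed
  then have "(\<Sum>x\<in>A. P x * ln (g x) - P x * ln c - P x * ln (P x)) \<le> (\<Sum>x\<in>A. g x / c - P x)"
    by (rule sum_mono)
  then show ?thesis
    using P(2) unfolding shannon_def
    by (simp add: sum_subtractf sum_negf flip: sum_distrib_right sum_divide_distrib)
qed

lemma shannon_le_ln_card:
  assumes "finite A" "A \<noteq> {}" and P: "\<And>x. x \<in> A \<Longrightarrow> 0 \<le> P x" "sum P A = 1"
  shows "shannon A P \<le> ln (card A)"
  using shannon_le_cross_entropy[of A P "\<lambda>_. 1" "card A"] assms
  by (simp add: card_gt_0_iff)

text \<open>
  \<open>a0\<close> and \<open>b\<close> are quantiles of order \<open>p\<close>. The point \<open>a\<close> maximises \<open>t / (4 * N) - P {1..<t}\<close> on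
  \<open>{a0..b}\<close>; this makes the mass grow at least linearly to the right of \<open>a\<close>, while \<open>{a0..<a}\<close> is so
  light that it hardly contributes to the entropy.
\<close>

lemma quantile_profile:
  fixes P :: "nat \<Rightarrow> real" and N :: nat and p :: real
  assumes N: "N \<ge> 1" and P: "\<And>x. 0 \<le> P x" "sum P {1..2*N} = 1" and p: "0 < p" "p \<le> 1/2"
  obtains a0 a b where "1 \<le> a0" "a0 \<le> a" "a \<le> b" "b \<le> 2 * N"
    "p \<le> sum P {1..a0}" "p \<le> sum P {b..2*N}"
    "sum P {1..<a} \<le> p + (real a - real a0) / (4 * N)" "sum P {b<..2*N} \<le> p"
    "\<And>t. a \<le> t \<Longrightarrow> t \<le> 2 * N \<Longrightarrow> (real t - real a) / (4 * N) \<le> sum P {1..<t}"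
proof -
  define a0 where "a0 = (LEAST t. p \<le> sum P {1..t})"
  have ex: "p \<le> sum P {1..2*N}" using p P by simp
  have a0: "p \<le> sum P {1..a0}" unfolding a0_def by (rule LeastI[of _ "2*N"]) (rule ex)
  have a0_le: "a0 \<le> 2*N" unfolding a0_def by (rule Least_le) (rule ex)
  have a0_ge: "1 \<le> a0" using a0 p by (cases a0) auto
  have below: "sum P {1..<a0} < p"
  proof -
    have "\<not> p \<le> sum P {1..a0-1}" using a0_ge not_less_Least[of "a0-1" "\<lambda>t. p \<le> sum P {1..t}"]
      unfolding a0_def by simp
    moreover have "{1..a0-1} = {1..<a0}" using a0_ge by auto
    ultimately show ?thesis by simp
  qed
  define b where "b = (GREATEST t. t \<le> 2*N \<and> p \<le> sum P {t..2*N})"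
  have b: "b \<le> 2*N \<and> p \<le> sum P {b..2*N}" unfolding b_def
    by (rule GreatestI_nat[of "\<lambda>t. t \<le> 2*N \<and> p \<le> sum P {t..2*N}" 1 "2*N"]) (use N ex in auto)
  have above: "sum P {b<..2*N} < p"
  proof (rule ccontr)
    assume "\<not> ?thesis"
    moreover have "{b<..2*N} = {Suc b..2*N}" by auto
    ultimately have *: "p \<le> sum P {Suc b..2*N}" by simp
    then have "Suc b \<le> 2*N" using p by (cases "Suc b \<le> 2*N") auto
    with * have "Suc b \<le> b"
      unfolding b_def by (intro Greatest_le_nat[of "\<lambda>t. t \<le> 2*N \<and> p \<le> sum P {t..2*N}" _ "2*N"]) auto
    then show False by simp
  qed
  have "a0 \<le> b"
  proof (rule ccontr)
    assume "\<not> a0 \<le> b"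
    then have "{1..2*N} = {1..<a0} \<union> {b<..2*N}" using a0_le by auto
    then have "1 \<le> sum P {1..<a0} + sum P {b<..2*N}"
      using P(2) sum.union_inter[of "{1..<a0}" "{b<..2*N}" P] sum_nonneg[of "{1..<a0} \<inter> {b<..2*N}" P] P(1)
      by simp
    then show False using below above p by simp
  qed
  define f where "f t = real t / (4*N) - sum P {1..<t}" for t
  obtain a where a: "a \<in> {a0..b}" "\<And>t. t \<in> {a0..b} \<Longrightarrow> f t \<le> f a"
  proof -
    have "Max (f ` {a0..b}) \<in> f ` {a0..b}" using \<open>a0 \<le> b\<close> by (intro Max_in) auto
    then obtain a where "a \<in> {a0..b}" "f a = Max (f ` {a0..b})" by auto
    then show ?thesis using that[of a] by simp
  qed
  have "sum P {1..<a} \<le> p + (real a - real a0) / (4 * N)"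
    using a(2)[of a0] \<open>a0 \<le> b\<close> below by (simp add: f_def diff_divide_distrib)
  moreover have "(real t - real a) / (4 * N) \<le> sum P {1..<t}" if t: "a \<le> t" "t \<le> 2 * N" for t
  proof (cases "t \<le> b")
    case True
    then show ?thesis using a(2)[of t] a(1) t sum_nonneg[of "{1..<a}" P] P
      by (simp add: f_def diff_divide_distrib)
  next
    case False
    \<comment> \<open>To the right of \<open>b\<close> maximality of \<open>a\<close> says nothing.
      There the mass below \<open>t\<close> is already at least \<open>1 - p \<ge> 1/2\<close>,
      while the required growth never exceeds \<open>2 * N / (4 * N) = 1/2\<close>.\<close>
    have "sum P {1..2*N} = sum P {1..b} + sum P {b<..2*N}"
    proof -
      have "{1..2*N} = {1..b} \<union> {b<..2*N}" using b a0_ge \<open>a0 \<le> b\<close> by auto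
      then show ?thesis by (simp only:) (subst sum.union_disjoint; auto)
    qed
    then have "1/2 \<le> sum P {1..b}" using P above p by simp
    also have "\<dots> \<le> sum P {1..<t}" using False P by (intro sum_mono2) auto
    finally have "1/2 \<le> sum P {1..<t}" .
    moreover have "(real t - real a) / (4 * N) \<le> 1/2"
      using t N by (simp add: field_simps)
    ultimately show ?thesis by linarith
  qed
  ultimately show ?thesis
    using that[of a0 a b] a0_ge a a0 b above by auto
qed

text \<open>The \<tau> points closest to \<open>m\<close> count at most 1 each. Below them
  \<open>growth\<close> gives \<open>v x / p^2 \<ge> s * r\<close> with
  \<open>r = 1 / (4 * N * p)\<close>, and the resulting geometric series is at most
  \<open>1 + 1 / r\<close>.\<close>

lemma sum_exp_tail_le:
  fixes v :: "nat \<Rightarrow> real" and N m \<tau> :: nat and p :: real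
  assumes N: "N \<ge> 1" and p: "p > 0" and v: "\<And>x. 0 \<le> v x"
    and growth: "\<And>x s. 1 \<le> x \<Longrightarrow> x + s + \<tau> = m \<Longrightarrow> p * (real s / (4 * N)) \<le> v x"
  shows "(\<Sum>x\<in>{1..<m}. exp (- v x / p^2)) \<le> real \<tau> + 1 + 4 * N * p"
proof -
  define r where "r = 1 / (4 * N * p)"
  have r: "r > 0" using N p by (simp add: r_def)
  have "(\<Sum>s<m. exp (- r) ^ s) = (1 - exp (-r) ^ m) / (1 - exp (-r))"
    using r by (simp add: sum_gp_strict)
  also have "\<dots> \<le> 1 / (1 - exp (-r))" using r by (intro divide_right_mono) auto
  also have "\<dots> \<le> 1 + 1 / r"
  proof -
    have "1 + r \<le> exp r" by (rule exp_ge_add_one_self)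
    then have "exp (-r) \<le> 1 / (1 + r)" using r by (simp add: exp_minus field_simps)
    then have "r / (1 + r) \<le> 1 - exp (-r)" using r by (simp add: field_simps)
    then have "1 / (1 - exp (-r)) \<le> 1 / (r / (1 + r))" using r by (intro divide_left_mono) auto
    also have "\<dots> = 1 + 1 / r" using r by (simp add: field_simps)
    finally show ?thesis .
  qed
  also have "1 + 1 / r = 1 + 4 * N * p" by (simp add: r_def)
  finally have gp: "(\<Sum>s<m. exp (- r) ^ s) \<le> 1 + 4 * N * p" .
  have "(\<Sum>x\<in>{1..<m}. exp (- v x / p^2)) = (\<Sum>t\<in>{1..<m}. exp (- v (m - t) / p^2))"
    by (rule sum.reindex_bij_witness[of _ "\<lambda>t. m - t" "\<lambda>t. m - t"]) auto
  also have "\<dots> \<le> (\<Sum>t\<in>{1..<m}. if t < \<tau> then 1 else exp (- r) ^ (t - \<tau>))"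
  proof (rule sum_mono)
    fix t assume t: "t \<in> {1..<m}"
    show "exp (- v (m - t) / p^2) \<le> (if t < \<tau> then 1 else exp (- r) ^ (t - \<tau>))"
    proof (cases "t < \<tau>")
      case True
      then show ?thesis using v p by simp
    next
      case False
      then have "p * (real (t - \<tau>) / (4 * N)) \<le> v (m - t)" using t by (intro growth) auto
      then have "p * (real (t - \<tau>) / (4 * N)) / p^2 \<le> v (m - t) / p^2"
        by (rule divide_right_mono) simp
      moreover have "p * (real (t - \<tau>) / (4 * N)) / p^2 = real (t - \<tau>) * r"
        using p N by (simp add: r_def field_simps power2_eq_square)
      ultimately show ?thesis using False by (simp flip: exp_of_nat_mult)
    qed
  qed
  also have "\<dots> \<le> (\<Sum>t\<in>{..<\<tau> + m}. if t < \<tau> then 1 else exp (- r) ^ (t - \<tau>))"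
    by (intro sum_mono2) auto
  also have "\<dots> = real \<tau> + (\<Sum>s<m. exp (- r) ^ s)"
  proof (induction m)
    case 0
    have "(\<Sum>t\<in>{..<\<tau>}. if t < \<tau> then 1 else exp (- r) ^ (t - \<tau>)) = (\<Sum>t\<in>{..<\<tau>}. 1)"
      by (rule sum.cong) auto
    then show ?case by simp
  qed simp
  finally show ?thesis using gp by simp
qed

lemma sum_split4:
  fixes f :: "nat \<Rightarrow> real"
  assumes "1 \<le> a0" "a0 \<le> a" "a \<le> b" "b \<le> M"
  shows "sum f {1..M} = sum f {1..<a0} + sum f {a0..<a} + sum f {a..b} + sum f {b<..M}"
proof -
  have "{1..M} = {1..b} \<union> {b<..M}" "{1..b} = {1..<a} \<union> {a..b}" using assms by auto
  then have "sum f {1..M} = sum f {1..b} + sum f {b<..M}" "sum f {1..b} = sum f {1..<a} + sum f {a..b}"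
    by (metis finite_atLeastAtMost finite_atLeastLessThan finite_greaterThanAtMost
        sum.union_disjoint ivl_disj_int)+
  moreover have "sum f {1..<a} = sum f {1..<a0} + sum f {a0..<a}"
    using assms by (simp add: sum.atLeastLessThan_concat)
  ultimately show ?thesis by simp
qed

text \<open>Cross entropy with \<open>c = N\<close> and a weight that is 1 on \<open>{a..b}\<close>,
  at most 1/4 elsewhere, and damped further by \<open>exp (- v x / p^2)\<close> below
  \<open>a0\<close>. The factor 1/4 costs \<open>ln 4\<close> per unit of light mass but saves three
  quarters of the length; the damping costs the mean of \<open>v\<close> divided by
  \<open>p^2\<close> and makes the region below \<open>a0\<close> nearly free.\<close>

lemma shannon_le_profile:
  fixes P v :: "nat \<Rightarrow> real" and N a0 a b \<tau> :: nat and p :: real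
  assumes N: "N \<ge> 1" and P: "\<And>x. 0 \<le> P x" "sum P {1..2*N} = 1" and p: "0 < p"
    and order: "1 \<le> a0" "a0 \<le> a" "a \<le> b" "b \<le> 2 * N"
    and light: "sum P {1..<a} \<le> p + (real a - real a0) / (4 * N)" "sum P {b<..2*N} \<le> p"
    and v: "\<And>x. 0 \<le> v x"
    and growth: "\<And>x s. 1 \<le> x \<Longrightarrow> x + s + \<tau> = a0 \<Longrightarrow> p * (real s / (4 * N)) \<le> v x"
  shows "shannon {1..2*N} P \<le> ln N - 1 + ln 4 * (2 * p + (real a - real a0) / (4 * N))
    + (\<Sum>x\<in>{1..2*N}. P x * v x) / p^2
    + ((real b + 1 - real a) + (2 * N - real b) / 4 + (real a - real a0) / 4 + (\<tau> + 1 + 4 * N * p) / 4) / N"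
proof -
  define g where "g x = (if a \<le> x \<and> x \<le> b then 1 else 1/4) * (if x < a0 then exp (- v x / p^2) else 1)" for x
  note split = sum_split4[OF order]
  have g0: "0 < g x" for x by (simp add: g_def)
  have "shannon {1..2*N} P \<le> (\<Sum>x\<in>{1..2*N}. P x * - ln (g x)) + sum g {1..2*N} / N - 1 + ln N"
    using P g0 N by (intro shannon_le_cross_entropy) auto
  moreover have "sum g {1..2*N} \<le> (real b + 1 - real a) + (2 * N - real b) / 4 + (real a - real a0) / 4
      + (\<tau> + 1 + 4 * N * p) / 4"
  proof -
    have "sum g {1..<a0} = (\<Sum>x\<in>{1..<a0}. exp (- v x / p^2)) / 4"
      unfolding sum_divide_distrib using order by (intro sum.cong) (auto simp: g_def)
    moreover have "sum g {a0..<a} = (\<Sum>x\<in>{a0..<a}. 1/4)" by (intro sum.cong) (auto simp: g_def)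
    moreover have "sum g {a..b} = (\<Sum>x\<in>{a..b}. 1)" using order by (intro sum.cong) (auto simp: g_def)
    moreover have "sum g {b<..2*N} = (\<Sum>x\<in>{b<..2*N}. 1/4)" using order by (intro sum.cong) (auto simp: g_def)
    moreover have "(\<Sum>x\<in>{1..<a0}. exp (- v x / p^2)) \<le> real \<tau> + 1 + 4 * N * p"
      by (rule sum_exp_tail_le[OF N p v]) (rule growth)
    ultimately show ?thesis
      unfolding split using order by (simp add: of_nat_diff) argo
  qed
  then have "sum g {1..2*N} / N \<le> ((real b + 1 - real a) + (2 * N - real b) / 4 + (real a - real a0) / 4
      + (\<tau> + 1 + 4 * N * p) / 4) / N"
    by (rule divide_right_mono) simp
  moreover have "(\<Sum>x\<in>{1..2*N}. P x * - ln (g x)) \<le> ln 4 * (2 * p + (real a - real a0) / (4 * N))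
      + (\<Sum>x\<in>{1..2*N}. P x * v x) / p^2"
  proof -
    have lng: "- ln (g x) = (if a \<le> x \<and> x \<le> b then 0 else ln 4) + (if x < a0 then v x / p^2 else 0)" for x
      by (simp add: g_def ln_mult ln_div)
    have "(\<Sum>x\<in>{1..2*N}. P x * - ln (g x))
      \<le> (\<Sum>x\<in>{1..2*N}. P x * (if a \<le> x \<and> x \<le> b then 0 else ln 4) + P x * v x / p^2)"
      unfolding lng using P(1) v by (intro sum_mono) (auto simp: algebra_simps)
    also have "\<dots> = (\<Sum>x\<in>{1..2*N}. P x * (if a \<le> x \<and> x \<le> b then 0 else ln 4))
      + (\<Sum>x\<in>{1..2*N}. P x * v x) / p^2"
      by (simp add: sum.distrib sum_divide_distrib)
    also have "(\<Sum>x\<in>{1..2*N}. P x * (if a \<le> x \<and> x \<le> b then 0 else ln 4))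
      = (sum P {1..<a} + sum P {b<..2*N}) * ln 4"
    proof -
      have "(\<Sum>x\<in>{a..b}. P x * (if a \<le> x \<and> x \<le> b then 0 else ln 4)) = (\<Sum>x\<in>{a..b}. 0)"
        by (intro sum.cong) auto
      moreover have "(\<Sum>x\<in>{b<..2*N}. P x * (if a \<le> x \<and> x \<le> b then 0 else ln 4)) = sum P {b<..2*N} * ln 4"
        unfolding sum_distrib_right using order by (intro sum.cong) auto
      moreover have "(\<Sum>x\<in>{1..<a}. P x * (if a \<le> x \<and> x \<le> b then 0 else ln 4)) = sum P {1..<a} * ln 4"
        unfolding sum_distrib_right using order by (intro sum.cong) auto
      ultimately show ?thesis
        unfolding split using sum.atLeastLessThan_concat[OF order(1,2), of "\<lambda>x. P x * (if a \<le> x \<and> x \<le> b then 0 else ln 4)"]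
        by (simp add: algebra_simps)
    qed
    also have "(sum P {1..<a} + sum P {b<..2*N}) * ln 4 \<le> (2 * p + (real a - real a0) / (4 * N)) * ln 4"
      using light by (intro mult_right_mono) auto
    finally show ?thesis by (simp add: mult.commute)
  qed
  ultimately show ?thesis by linarith
qed

section \<open>Triangle violations for independent edges\<close>

definition tri_violated :: "nat \<Rightarrow> nat \<Rightarrow> nat \<Rightarrow> bool" where
  "tri_violated x y z \<longleftrightarrow> x + y < z \<or> y + z < x \<or> z + x < y"

lemma tri_violated_rotate: "tri_violated y z x \<longleftrightarrow> tri_violated x y z"
  by (auto simp: tri_violated_def)

text \<open>With \<open>x\<close> summed last, the inner double sum is the conditional violation
  probability given \<open>x\<close>, which becomes the damping function \<open>v\<close> of
  \<open>shannon_le_profile\<close>.\<close>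

definition violation_prob :: "nat set \<Rightarrow> (nat \<Rightarrow> real) \<Rightarrow> (nat \<Rightarrow> real) \<Rightarrow> (nat \<Rightarrow> real) \<Rightarrow> real" where
  "violation_prob V P Q R = (\<Sum>x\<in>V. P x * (\<Sum>y\<in>V. \<Sum>z\<in>V. of_bool (tri_violated x y z) * Q y * R z))"

lemma violation_prob_rotate: "violation_prob V Q R P = violation_prob V P Q R"
proof -
  have "violation_prob V Q R P = (\<Sum>y\<in>V. \<Sum>z\<in>V. \<Sum>x\<in>V. of_bool (tri_violated y z x) * P x * Q y * R z)"
    unfolding violation_prob_def sum_distrib_left by (simp add: mult_ac)
  also have "\<dots> = (\<Sum>y\<in>V. \<Sum>z\<in>V. \<Sum>x\<in>V. of_bool (tri_violated x y z) * P x * Q y * R z)"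
    by (intro sum.cong refl) (subst tri_violated_rotate, rule refl)
  also have "\<dots> = (\<Sum>y\<in>V. \<Sum>x\<in>V. \<Sum>z\<in>V. of_bool (tri_violated x y z) * P x * Q y * R z)"
    by (intro sum.cong refl sum.swap)
  also have "\<dots> = (\<Sum>x\<in>V. \<Sum>y\<in>V. \<Sum>z\<in>V. of_bool (tri_violated x y z) * P x * Q y * R z)"
    by (rule sum.swap)
  also have "\<dots> = violation_prob V P Q R"
    unfolding violation_prob_def sum_distrib_left by (simp add: mult_ac)
  finally show ?thesis .
qed

lemma violation_given_ge:
  fixes Q R :: "nat \<Rightarrow> real"
  assumes "finite V" "\<And>x. 0 \<le> Q x" "\<And>x. 0 \<le> R x"
    and "A \<subseteq> V" "B \<subseteq> V" "\<And>y z. y \<in> A \<Longrightarrow> z \<in> B \<Longrightarrow> tri_violated x y z"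
  shows "sum Q A * sum R B \<le> (\<Sum>y\<in>V. \<Sum>z\<in>V. of_bool (tri_violated x y z) * Q y * R z)"
proof -
  have fin: "finite A" "finite B" using assms(1,4,5) by (auto intro: finite_subset)
  have "sum Q A * sum R B = (\<Sum>y\<in>A. \<Sum>z\<in>B. of_bool (tri_violated x y z) * Q y * R z)"
    using assms(6) by (simp add: sum_product)
  also have "\<dots> \<le> (\<Sum>y\<in>A. \<Sum>z\<in>V. of_bool (tri_violated x y z) * Q y * R z)"
    using assms by (intro sum_mono sum_mono2) auto
  also have "\<dots> \<le> (\<Sum>y\<in>V. \<Sum>z\<in>V. of_bool (tri_violated x y z) * Q y * R z)"
    using assms by (intro sum_mono2 sum_nonneg) auto
  finally show ?thesis .
qed

text \<open>Otherwise every triple in the box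
  \<open>{1..a1} \<times> {1..a2} \<times> {b..M}\<close> is violated, and this box alone has
  product mass at least \<open>p ^ 3\<close>.\<close>

lemma quantile_triangle:
  fixes P Q R :: "nat \<Rightarrow> real" and p :: real
  assumes nonneg: "\<And>x. 0 \<le> P x" "\<And>x. 0 \<le> Q x" "\<And>x. 0 \<le> R x" and p: "0 < p"
    and "violation_prob {1..M} P Q R < p ^ 3"
    and quant: "p \<le> sum P {1..a1}" "p \<le> sum Q {1..a2}" "p \<le> sum R {b..M}"
    and "a1 \<le> M" "a2 \<le> M" "1 \<le> b"
  shows "b \<le> a1 + a2"
proof (rule ccontr)
  assume "\<not> b \<le> a1 + a2"
  then have "sum Q {1..a2} * sum R {b..M} \<le> (\<Sum>y\<in>{1..M}. \<Sum>z\<in>{1..M}. of_bool (tri_violated x y z) * Q y * R z)"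
    if "x \<in> {1..a1}" for x
    using that assms by (intro violation_given_ge) (auto simp: tri_violated_def)
  then have "(\<Sum>x\<in>{1..a1}. P x * (sum Q {1..a2} * sum R {b..M}))
      \<le> (\<Sum>x\<in>{1..a1}. P x * (\<Sum>y\<in>{1..M}. \<Sum>z\<in>{1..M}. of_bool (tri_violated x y z) * Q y * R z))"
    using nonneg by (intro sum_mono mult_left_mono) auto
  also have "\<dots> \<le> violation_prob {1..M} P Q R"
    unfolding violation_prob_def using nonneg assms(9)
    by (intro sum_mono2 mult_nonneg_nonneg sum_nonneg) auto
  finally have "sum P {1..a1} * (sum Q {1..a2} * sum R {b..M}) < p ^ 3"
    using assms(5) by (simp add: sum_distrib_right)
  moreover have "p * (p * p) \<le> sum P {1..a1} * (sum Q {1..a2} * sum R {b..M})"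
    using p quant nonneg by (intro mult_mono mult_nonneg_nonneg sum_nonneg) auto
  ultimately show False by (simp add: power3_eq_cube mult.assoc)
qed



text \<open>
  The roles of \<open>(P, Q, R)\<close> are arranged so that, when the three rotations of this bound are added,
  all terms containing the quantiles sum to something nonpositive.
\<close>

lemma shannon_le_rotation:
  fixes P Q R :: "nat \<Rightarrow> real" and N :: nat and p :: real
  assumes N: "N \<ge> 1" and P: "\<And>x. 0 \<le> P x" "sum P {1..2*N} = 1"
    and nonneg: "\<And>x. 0 \<le> Q x" "\<And>x. 0 \<le> R x" and p: "0 < p"
    and order: "1 \<le> a0" "a0 \<le> a" "a \<le> b" "b \<le> 2 * N" "a0' \<le> a'" "1 \<le> b''" "b'' \<le> 2 * N"
    and light: "sum P {1..<a} \<le> p + (real a - real a0) / (4 * N)" "sum P {b<..2*N} \<le> p"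
    and grow: "\<And>t. a' \<le> t \<Longrightarrow> t \<le> 2 * N \<Longrightarrow> (real t - real a') / (4 * N) \<le> sum Q {1..<t}"
    and top: "p \<le> sum R {b''..2*N}"
    and tri: "b'' \<le> a0 + a0'"
  shows "shannon {1..2*N} P \<le> ln N - 1 + ln 4 * (2 * p + (real a - real a0) / (4 * N))
    + violation_prob {1..2*N} P Q R / p^2
    + ((real b + 1 - real a) + (2 * N - real b) / 4 + (real a - real a0) / 4
       + ((real a0 + real a' - real b'') + 1 + 4 * N * p) / 4) / N"
proof -
  define v where "v x = (\<Sum>y\<in>{1..2*N}. \<Sum>z\<in>{1..2*N}. of_bool (tri_violated x y z) * Q y * R z)" for x
  \<comment> \<open>For \<open>x = a0 - \<tau> - s\<close> one has \<open>b'' - x = a' + s\<close>.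
    All \<open>y < b'' - x\<close> and \<open>z \<ge> b''\<close> are then violated with
    \<open>x\<close>, and the growth of \<open>Q\<close> to the right of \<open>a'\<close> gives
    probability at least \<open>p * s / (4 * N)\<close>. By \<open>tri\<close> the subtraction is
    not truncated.\<close>
  define \<tau> where "\<tau> = a0 + a' - b''"
  have \<tau>: "\<tau> + b'' = a0 + a'" "real \<tau> = real a0 + real a' - real b''"
    using tri order by (auto simp: \<tau>_def of_nat_diff)
  have v0: "0 \<le> v x" for x unfolding v_def using nonneg by (intro sum_nonneg) auto
  have growth: "p * (real s / (4 * N)) \<le> v x" if "1 \<le> x" "x + s + \<tau> = a0" for x s
  proof -
    have t: "b'' - x = a' + s" using \<tau> that by linarith
    have "(real (b'' - x) - real a') / (4 * N) \<le> sum Q {1..<b'' - x}"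
      using t order by (intro grow) auto
    then have "real s / (4 * N) \<le> sum Q {1..<b'' - x}" by (simp add: t)
    then have "real s / (4 * N) * p \<le> sum Q {1..<b'' - x} * sum R {b''..2*N}"
      using top p nonneg by (intro mult_mono sum_nonneg) auto
    also have "\<dots> \<le> v x" unfolding v_def
      using nonneg order by (intro violation_given_ge) (auto simp: tri_violated_def)
    finally show ?thesis by (simp add: mult.commute)
  qed
  have "shannon {1..2*N} P \<le> ln N - 1 + ln 4 * (2 * p + (real a - real a0) / (4 * N))
    + (\<Sum>x\<in>{1..2*N}. P x * v x) / p^2
    + ((real b + 1 - real a) + (2 * N - real b) / 4 + (real a - real a0) / 4 + (\<tau> + 1 + 4 * N * p) / 4) / N"
    by (rule shannon_le_profile[OF N P p order(1-4) light v0]) (rule growth)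
  then show ?thesis
    using \<tau>(2) by (simp add: violation_prob_def v_def add_divide_distrib)
qed

lemma ln_4_le: "ln (4::real) \<le> 7/5"
proof -
  have "ln (4::real) = 2 * ln 2" using ln_realpow[of "2::real" 2] by simp
  then show ?thesis using ln2_le_25_over_36 by linarith
qed

text \<open>By \<open>quantile_triangle\<close> each upper quantile is at most the sum of the lower
  quantiles of the other two edges, so \<open>B \<le> 2 * D\<close>. This is what makes the quantile
  terms harmless when the three rotations are added.\<close>

lemma shannon_triangle_small:
  fixes P Q R :: "nat \<Rightarrow> real" and N :: nat and p :: real
  assumes N: "N \<ge> 1" and P: "\<And>x. 0 \<le> P x" "sum P {1..2*N} = 1"
    and Q: "\<And>x. 0 \<le> Q x" "sum Q {1..2*N} = 1" and R: "\<And>x. 0 \<le> R x" "sum R {1..2*N} = 1"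
    and p: "0 < p" "p \<le> 1/2" and small: "violation_prob {1..2*N} P Q R < p ^ 3"
  shows "shannon {1..2*N} P + shannon {1..2*N} Q + shannon {1..2*N} R
    \<le> 3 * ln N + 12 * p + 3 * (violation_prob {1..2*N} P Q R / p^2) + 4 / N"
proof -
  let ?q = "violation_prob {1..2*N} P Q R"
  have q: "violation_prob {1..2*N} Q R P = ?q" "violation_prob {1..2*N} R P Q = ?q"
    using violation_prob_rotate[of "{1..2*N}"] by metis+
  from quantile_profile[OF N P p] obtain c1 a1 b1 where
    1: "1 \<le> c1" "c1 \<le> a1" "a1 \<le> b1" "b1 \<le> 2 * N"
    "p \<le> sum P {1..c1}" "p \<le> sum P {b1..2*N}"
    "sum P {1..<a1} \<le> p + (real a1 - real c1) / (4 * N)" "sum P {b1<..2*N} \<le> p"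
    "\<And>t. a1 \<le> t \<Longrightarrow> t \<le> 2 * N \<Longrightarrow> (real t - real a1) / (4 * N) \<le> sum P {1..<t}" by blast
  from quantile_profile[OF N Q p] obtain c2 a2 b2 where
    2: "1 \<le> c2" "c2 \<le> a2" "a2 \<le> b2" "b2 \<le> 2 * N"
    "p \<le> sum Q {1..c2}" "p \<le> sum Q {b2..2*N}"
    "sum Q {1..<a2} \<le> p + (real a2 - real c2) / (4 * N)" "sum Q {b2<..2*N} \<le> p"
    "\<And>t. a2 \<le> t \<Longrightarrow> t \<le> 2 * N \<Longrightarrow> (real t - real a2) / (4 * N) \<le> sum Q {1..<t}" by blast
  from quantile_profile[OF N R p] obtain c3 a3 b3 where
    3: "1 \<le> c3" "c3 \<le> a3" "a3 \<le> b3" "b3 \<le> 2 * N"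
    "p \<le> sum R {1..c3}" "p \<le> sum R {b3..2*N}"
    "sum R {1..<a3} \<le> p + (real a3 - real c3) / (4 * N)" "sum R {b3<..2*N} \<le> p"
    "\<And>t. a3 \<le> t \<Longrightarrow> t \<le> 2 * N \<Longrightarrow> (real t - real a3) / (4 * N) \<le> sum R {1..<t}" by blast
  have t3: "b3 \<le> c1 + c2"
    by (rule quantile_triangle[OF P(1) Q(1) R(1) p(1) small 1(5) 2(5) 3(6)]) (use 1 2 3 in auto)
  have t1: "b1 \<le> c2 + c3"
    by (rule quantile_triangle[OF Q(1) R(1) P(1) p(1) _ 2(5) 3(5) 1(6)]) (use 1 2 3 small q in auto)
  have t2: "b2 \<le> c3 + c1"
    by (rule quantile_triangle[OF R(1) P(1) Q(1) p(1) _ 3(5) 1(5) 2(6)]) (use 1 2 3 small q in auto)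
  have "1 \<le> b1" "1 \<le> b2" "1 \<le> b3" using 1 2 3 by auto
  note b = this
  define B where "B = real b1 + b2 + b3"
  define A where "A = real a1 + a2 + a3"
  define D where "D = real c1 + c2 + c3"
  have u: "(real a1 - c1) / (4 * N) + (real a2 - c2) / (4 * N) + (real a3 - c3) / (4 * N) = (A - D) / (4 * N)"
    unfolding A_def D_def by (simp flip: add_divide_distrib)
  have ln4: "ln 4 * (2 * p + (real a1 - c1) / (4 * N)) + ln 4 * (2 * p + (real a2 - c2) / (4 * N))
      + ln 4 * (2 * p + (real a3 - c3) / (4 * N)) = ln 4 * (6 * p + (A - D) / (4 * N))"
    unfolding u[symmetric] by (simp add: distrib_left)
  have S: "((real b1 + 1 - real a1) + (2 * N - real b1) / 4 + (real a1 - real c1) / 4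
       + ((real c1 + real a2 - real b3) + 1 + 4 * N * p) / 4) / N
     + ((real b2 + 1 - real a2) + (2 * N - real b2) / 4 + (real a2 - real c2) / 4
       + ((real c2 + real a3 - real b1) + 1 + 4 * N * p) / 4) / N
     + ((real b3 + 1 - real a3) + (2 * N - real b3) / 4 + (real a3 - real c3) / 4
       + ((real c3 + real a1 - real b2) + 1 + 4 * N * p) / 4) / N
     = (B/2 - A/2 + 15/4 + 3/2 * N + 3 * N * p) / N"
    unfolding A_def B_def add_divide_distrib[symmetric] by (intro arg_cong[of _ _ "\<lambda>x. x / real N"]) (simp add: field_simps)
  have 4: "shannon {1..2*N} P + shannon {1..2*N} Q + shannon {1..2*N} R
    \<le> 3 * ln N - 3 + ln 4 * (6 * p + (A - D) / (4 * N)) + 3 * (?q / p^2) +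
      (B/2 - A/2 + 15/4 + 3/2 * N + 3 * N * p) / N"
    using shannon_le_rotation[OF N P Q(1) R(1) p(1) 1(1-4) 2(2) b(3) 3(4) 1(7,8) 2(9) 3(6) t3]
      shannon_le_rotation[OF N Q R(1) P(1) p(1) 2(1-4) 3(2) b(1) 1(4) 2(7,8) 3(9) 1(6) t1]
      shannon_le_rotation[OF N R P(1) Q(1) p(1) 3(1-4) 1(2) b(2) 2(4) 3(7,8) 1(9) 2(6) t2]
    unfolding q using ln4 S by linarith
  have BD: "B \<le> 2 * D" "B \<le> 6 * real N" "D \<le> A" unfolding A_def B_def D_def using t1 t2 t3 1(1-4) 2(1-4) 3(1-4) by auto
  have "ln 4 * (A - D) \<le> 7/5 * (A - D)" using ln_4_le BD by (intro mult_right_mono) auto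
  \<comment> \<open>Half of \<open>B/2\<close> is bounded by \<open>D/2\<close>, the other half by
    \<open>3/2 * N\<close>. What remains is \<open>(ln 4 / 4 - 1/2) * (A - D)\<close>, nonpositive
    because \<open>ln 4 < 2\<close> and \<open>D \<le> A\<close>.\<close>
  then have "ln 4 * (A - D) / 4 + B/2 - A/2 - 3/2 * real N \<le> 0" using BD by argo
  then have "(ln 4 * (A - D) / 4 + B/2 - A/2 - 3/2 * N) / N \<le> 0" by (simp add: divide_le_0_iff)
  moreover have "(ln 4 * (A - D) / 4 + B/2 - A/2 - 3/2 * N) / N =
     ln 4 * ((A - D) / (4 * N)) + (B/2 - A/2 + 3/2 * N) / N - 3"
    using N by (simp add: field_simps)
  moreover have "(B/2 - A/2 + 15/4 + 3/2 * N + 3 * N * p) / N = (B/2 - A/2 + 3/2 * N) / N + 15/4 / N + 3 * p"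
    using N by (simp add: field_simps)
  \<comment> \<open>The constant 12 dominates \<open>6 * 7/5 + 3\<close>, the last summand coming
    from the geometric tails.\<close>
  moreover have "ln 4 * (6 * p) \<le> 7/5 * (6 * p)" using ln_4_le p by (intro mult_right_mono) auto
  moreover have "15/4 / real N \<le> 4 / N" by (intro divide_right_mono) auto
  ultimately show ?thesis using 4 p distrib_left[of "ln 4" "6 * p" "(A - D) / (4 * N)"] by linarith
qed

text \<open>Removes the smallness assumption by raising the threshold when the violation probability
  is too large for \<open>p\<close>. A threshold above 1/2 needs only the trivial bound
  \<open>ln (2 * N)\<close> per edge, since \<open>3 * ln 2 < 6\<close>.\<close>

lemma shannon_triangle:
  fixes P Q R :: "nat \<Rightarrow> real" and N :: nat and p :: real
  assumes N: "N \<ge> 1" and P: "\<And>x. 0 \<le> P x" "sum P {1..2*N} = 1"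
    and Q: "\<And>x. 0 \<le> Q x" "sum Q {1..2*N} = 1" and R: "\<And>x. 0 \<le> R x" "sum R {1..2*N} = 1"
    and p: "0 < p"
  shows "shannon {1..2*N} P + shannon {1..2*N} Q + shannon {1..2*N} R
    \<le> 3 * ln N + 12 * p + 30 * (violation_prob {1..2*N} P Q R / p^2) + 4 / N"
proof -
  define q where "q = violation_prob {1..2*N} P Q R"
  have q0: "0 \<le> q" unfolding q_def violation_prob_def
    using P Q R by (intro sum_nonneg mult_nonneg_nonneg) auto
  have trivial: "shannon {1..2*N} P + shannon {1..2*N} Q + shannon {1..2*N} R
      \<le> 3 * ln N + 12 * r + 4 / N" if "r > 1/2" for r :: real
  proof -
    have l: "ln (card {1..2*N}) = ln N + ln 2" using N by (simp add: ln_mult)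
    have "shannon {1..2*N} P \<le> ln N + ln 2" "shannon {1..2*N} Q \<le> ln N + ln 2"
      "shannon {1..2*N} R \<le> ln N + ln 2"
      unfolding l[symmetric] using N P Q R by (intro shannon_le_ln_card; simp)+
    moreover have "4 / real N \<ge> 0" by simp
    ultimately show ?thesis using that ln2_le_25_over_36 by linarith
  qed
  show ?thesis
  proof (cases "q < p ^ 3")
    case True
    show ?thesis
    proof (cases "p \<le> 1/2")
      case True
      have "0 \<le> q / p^2" using q0 by simp
      with shannon_triangle_small[OF N P Q R p True] \<open>q < p ^ 3\<close> show ?thesis
        unfolding q_def by linarith
    next
      case False
      moreover have "0 \<le> q / p^2" using q0 by simp
      ultimately show ?thesis using trivial[of p] unfolding q_def by linarith
    qed
  next
    case False
    \<comment> \<open>Since \<open>p ^ 3 \<le> q\<close>, this threshold satisfies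
      \<open>r ^ 3 = 8 * q ^ 3 / p ^ 6 > q\<close>. Then \<open>q / r^2 \<le> r\<close>, and
      \<open>12 * r + 3 * r = 30 * (q / p^2)\<close>.\<close>
    define r where "r = 2 * (q / p^2)"
    have qp: "p ^ 3 \<le> q" using False by simp
    then have q: "q > 0" using less_le_trans[OF zero_less_power[OF p, of 3] qp] by simp
    then have r: "r > 0" using p by (simp add: r_def)
    have bound: "shannon {1..2*N} P + shannon {1..2*N} Q + shannon {1..2*N} R
        \<le> 3 * ln N + 15 * r + 4 / N"
    proof (cases "r \<le> 1/2")
      case True
      have "q < r ^ 3"
      proof -
        have "p ^ 3 * p ^ 3 \<le> q * q" using qp p q by (intro mult_mono) auto
        then have "q * (p ^ 3 * p ^ 3) \<le> q * (q * q)" using q by (intro mult_left_mono) auto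
        also have "\<dots> < 8 * (q * (q * q))" using q by simp
        finally have "q * p ^ 6 < 8 * q ^ 3" by (simp add: power3_eq_cube eval_nat_numeral)
        then have "q < 8 * q ^ 3 / p ^ 6" using p by (simp add: pos_less_divide_eq)
        also have "\<dots> = r ^ 3" by (simp add: r_def power_divide power_mult_distrib flip: power_mult)
        finally show ?thesis .
      qed
      moreover from this have "q / r^2 \<le> r" using r
        by (simp add: pos_divide_le_eq power3_eq_cube power2_eq_square)
      ultimately show ?thesis
        using shannon_triangle_small[OF N P Q R r True] unfolding q_def by linarith
    next
      case False
      then show ?thesis using trivial[of r] by linarith
    qed
    then show ?thesis using p unfolding r_def q_def by linarith
  qed
qed

subsection \<open>Entropy of uniformly distributed data\<close>

text \<open>
  For uniform \<open>\<omega>\<close> in \<open>\<Omega>\<close>, the entropy of \<open>K \<omega>\<close> is \<open>ln (card \<Omega>) - log_cls \<Omega> K / card \<Omega>\<close>; conditional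
  entropies are differences of values of \<open>log_cls\<close>.
\<close>

definition log_cls :: "'a set \<Rightarrow> ('a \<Rightarrow> 'k) \<Rightarrow> real" where
  "log_cls \<Omega> K = (\<Sum>\<omega>\<in>\<Omega>. ln (card {\<omega>'\<in>\<Omega>. K \<omega>' = K \<omega>}))"

lemma card_cls_pos: "finite \<Omega> \<Longrightarrow> \<omega> \<in> \<Omega> \<Longrightarrow> 0 < card {\<omega>'\<in>\<Omega>. K \<omega>' = K \<omega>}"
  by (auto simp: card_gt_0_iff)

lemma log_cls_cong:
  assumes "\<And>\<omega> \<omega>'. \<omega> \<in> \<Omega> \<Longrightarrow> \<omega>' \<in> \<Omega> \<Longrightarrow> K \<omega>' = K \<omega> \<longleftrightarrow> K' \<omega>' = K' \<omega>"
  shows "log_cls \<Omega> K = log_cls \<Omega> K'"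
proof -
  have "{\<omega>'\<in>\<Omega>. K \<omega>' = K \<omega>} = {\<omega>'\<in>\<Omega>. K' \<omega>' = K' \<omega>}" if "\<omega> \<in> \<Omega>" for \<omega>
    using assms that by blast
  then show ?thesis unfolding log_cls_def by (intro sum.cong) auto
qed

lemma sum_div_card_cls:
  fixes f :: "'k \<Rightarrow> real"
  assumes "finite \<Omega>"
  shows "(\<Sum>\<omega>\<in>\<Omega>. f (K \<omega>) / card {\<omega>'\<in>\<Omega>. K \<omega>' = K \<omega>}) = sum f (K ` \<Omega>)"
proof -
  have "(\<Sum>\<omega>\<in>\<Omega>. f (K \<omega>) / card {\<omega>'\<in>\<Omega>. K \<omega>' = K \<omega>})
    = (\<Sum>k\<in>K ` \<Omega>. \<Sum>\<omega>\<in>{\<omega>\<in>\<Omega>. K \<omega> = k}. f (K \<omega>) / card {\<omega>'\<in>\<Omega>. K \<omega>' = K \<omega>})"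
    by (rule sum.image_gen[OF assms])
  also have "\<dots> = (\<Sum>k\<in>K ` \<Omega>. f k)"
  proof (rule sum.cong)
    fix k assume "k \<in> K ` \<Omega>"
    then have "card {\<omega>\<in>\<Omega>. K \<omega> = k} > 0" using assms by (auto simp: card_gt_0_iff)
    then show "(\<Sum>\<omega>\<in>{\<omega>\<in>\<Omega>. K \<omega> = k}. f (K \<omega>) / card {\<omega>'\<in>\<Omega>. K \<omega>' = K \<omega>}) = f k" by simp
  qed simp
  finally show ?thesis .
qed

lemma log_cls_fibres:
  assumes "finite \<Omega>"
  shows "log_cls \<Omega> F = (\<Sum>k\<in>F ` \<Omega>. card {\<omega>\<in>\<Omega>. F \<omega> = k} * ln (card {\<omega>\<in>\<Omega>. F \<omega> = k}))"
  unfolding log_cls_def by (subst sum.image_gen[OF assms, of _ F]) simp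

text \<open>The chain rule: conditioning on \<open>F\<close> means summing over its fibres, so
  unconditional inequalities lift to conditional ones fibre by fibre.\<close>

lemma log_cls_pair_fibres:
  assumes "finite \<Omega>"
  shows "log_cls \<Omega> (\<lambda>\<omega>. (F \<omega>, X \<omega>)) = (\<Sum>k\<in>F ` \<Omega>. log_cls {\<omega>\<in>\<Omega>. F \<omega> = k} X)"
  unfolding log_cls_def
  by (subst sum.image_gen[OF assms, of _ F], intro sum.cong refl) (auto intro!: arg_cong[of _ _ card])

lemma card_fibres:
  assumes "finite \<Omega>"
  shows "real (card \<Omega>) = (\<Sum>k\<in>F ` \<Omega>. real (card {\<omega>\<in>\<Omega>. F \<omega> = k}))"
  using sum.image_gen[OF assms, of "\<lambda>_. 1::real" F] by simp

text \<open>Nonnegativity of mutual information. Summing \<open>ln t \<le> t - 1\<close> for the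
  ratio \<open>t = c * d / (e * n)\<close> of product law to joint law leaves at most 0, because the
  attained pairs carry product mass at most 1.\<close>

lemma log_cls_product:
  assumes "finite \<Phi>"
  shows "log_cls \<Phi> X + log_cls \<Phi> Y \<le> card \<Phi> * ln (card \<Phi>) + log_cls \<Phi> (\<lambda>\<omega>. (X \<omega>, Y \<omega>))"
proof (cases "\<Phi> = {}")
  case False
  define n where "n = real (card \<Phi>)"
  have n: "n > 0" unfolding n_def using False assms by (simp add: card_gt_0_iff)
  define c where "c \<omega> = real (card {\<omega>'\<in>\<Phi>. X \<omega>' = X \<omega>})" for \<omega>
  define d where "d \<omega> = real (card {\<omega>'\<in>\<Phi>. Y \<omega>' = Y \<omega>})" for \<omega>
  define e where "e \<omega> = real (card {\<omega>'\<in>\<Phi>. (X \<omega>', Y \<omega>') = (X \<omega>, Y \<omega>)})" for \<omega>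
  define C where "C x = real (card {\<omega>\<in>\<Phi>. X \<omega> = x})" for x
  define D where "D y = real (card {\<omega>\<in>\<Phi>. Y \<omega> = y})" for y
  have pos: "c \<omega> > 0" "d \<omega> > 0" "e \<omega> > 0" if "\<omega> \<in> \<Phi>" for \<omega>
    using card_cls_pos[OF assms that, of X] card_cls_pos[OF assms that, of Y]
      card_cls_pos[OF assms that, of "\<lambda>\<omega>. (X \<omega>, Y \<omega>)"] unfolding c_def d_def e_def by auto
  have "ln (c \<omega>) + ln (d \<omega>) - ln n - ln (e \<omega>) \<le> c \<omega> * d \<omega> / e \<omega> / n - 1" if "\<omega> \<in> \<Phi>" for \<omega>
    using ln_le_minus_one[of "c \<omega> * d \<omega> / e \<omega> / n"] pos[OF that] n by (simp add: ln_mult ln_div)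
  then have "(\<Sum>\<omega>\<in>\<Phi>. ln (c \<omega>) + ln (d \<omega>) - ln n - ln (e \<omega>)) \<le> (\<Sum>\<omega>\<in>\<Phi>. c \<omega> * d \<omega> / e \<omega> / n - 1)"
    by (rule sum_mono)
  also have "\<dots> = (\<Sum>\<omega>\<in>\<Phi>. c \<omega> * d \<omega> / e \<omega>) / n - n"
    by (simp add: sum_subtractf n_def sum_divide_distrib)
  also have "(\<Sum>\<omega>\<in>\<Phi>. c \<omega> * d \<omega> / e \<omega>) = (\<Sum>(x, y)\<in>(\<lambda>\<omega>. (X \<omega>, Y \<omega>)) ` \<Phi>. C x * D y)"
    using sum_div_card_cls[OF assms, of "\<lambda>(x, y). C x * D y" "\<lambda>\<omega>. (X \<omega>, Y \<omega>)"]
    by (simp add: c_def d_def e_def C_def D_def)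
  also have "\<dots> \<le> (\<Sum>(x, y)\<in>X ` \<Phi> \<times> Y ` \<Phi>. C x * D y)"
    using assms by (intro sum_mono2) (auto simp: C_def D_def)
  also have "\<dots> = sum C (X ` \<Phi>) * sum D (Y ` \<Phi>)"
    by (simp add: sum_product sum.cartesian_product)
  also have "\<dots> = n * n"
    unfolding n_def C_def D_def card_fibres[OF assms, of X, symmetric] card_fibres[OF assms, of Y, symmetric] ..
  finally have "(\<Sum>\<omega>\<in>\<Phi>. ln (c \<omega>) + ln (d \<omega>) - ln n - ln (e \<omega>)) \<le> n * n / n - n"
    using n by (simp add: divide_right_mono)
  then show ?thesis using n
    by (simp add: sum_subtractf sum.distrib log_cls_def c_def d_def e_def n_def)
qed (simp add: log_cls_def)

text \<open>Conditional mutual information given \<open>F\<close> is nonnegative, by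
  \<open>log_cls_product\<close> on each fibre.\<close>

lemma log_cls_submodular:
  assumes "finite \<Omega>"
  shows "log_cls \<Omega> (\<lambda>\<omega>. (F \<omega>, X \<omega>)) + log_cls \<Omega> (\<lambda>\<omega>. (F \<omega>, Y \<omega>))
    \<le> log_cls \<Omega> F + log_cls \<Omega> (\<lambda>\<omega>. (F \<omega>, X \<omega>, Y \<omega>))"
  unfolding log_cls_pair_fibres[OF assms] log_cls_fibres[OF assms, of F] sum.distrib[symmetric]
  by (intro sum_mono log_cls_product) (use assms in auto)

section \<open>Empirical marginals and the information carried by a triangle\<close>

definition empirical :: "'a set \<Rightarrow> ('a \<Rightarrow> 'k) \<Rightarrow> 'k \<Rightarrow> real" where
  "empirical \<Phi> X x = card {\<omega>\<in>\<Phi>. X \<omega> = x} / card \<Phi>"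

lemma empirical_nonneg: "0 \<le> empirical \<Phi> X x"
  by (simp add: empirical_def)

lemma sum_empirical:
  assumes "finite \<Phi>" "\<Phi> \<noteq> {}" "finite A" "X ` \<Phi> \<subseteq> A"
  shows "sum (empirical \<Phi> X) A = 1"
proof -
  have "sum (empirical \<Phi> X) A = sum (empirical \<Phi> X) (X ` \<Phi>)"
    using assms by (intro sum.mono_neutral_right) (auto simp: empirical_def)
  also have "\<dots> = 1"
    unfolding empirical_def sum_divide_distrib[symmetric] card_fibres[OF assms(1), of X, symmetric]
    using assms(1,2) by simp
  finally show ?thesis .
qed

lemma shannon_empirical:
  assumes "finite \<Phi>" "\<Phi> \<noteq> {}" "finite A" "X ` \<Phi> \<subseteq> A"
  shows "card \<Phi> * shannon A (empirical \<Phi> X) = card \<Phi> * ln (card \<Phi>) - log_cls \<Phi> X"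
proof -
  define n where "n = real (card \<Phi>)"
  have n: "n > 0" unfolding n_def using assms by (simp add: card_gt_0_iff)
  define C where "C x = real (card {\<omega>\<in>\<Phi>. X \<omega> = x})" for x
  have "shannon A (empirical \<Phi> X) = shannon (X ` \<Phi>) (empirical \<Phi> X)"
    unfolding shannon_def using assms
    by (intro arg_cong[of _ _ uminus] sum.mono_neutral_right) (auto simp: empirical_def)
  also have "\<dots> = - (\<Sum>x\<in>X ` \<Phi>. (C x * ln (C x) - C x * ln n) / n)"
    unfolding shannon_def
  proof (intro arg_cong[of _ _ uminus] sum.cong refl)
    fix x assume "x \<in> X ` \<Phi>"
    then have "C x > 0" using assms(1) by (auto simp: C_def card_gt_0_iff)
    then show "empirical \<Phi> X x * ln (empirical \<Phi> X x) = (C x * ln (C x) - C x * ln n) / n"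
      using n by (simp add: empirical_def C_def n_def ln_div algebra_simps diff_divide_distrib)
  qed
  also have "\<dots> = - ((\<Sum>x\<in>X ` \<Phi>. C x * ln (C x)) - (\<Sum>x\<in>X ` \<Phi>. C x) * ln n) / n"
    unfolding sum_divide_distrib[symmetric] sum_subtractf sum_distrib_right[symmetric] by (rule minus_divide_left)
  also have "(\<Sum>x\<in>X ` \<Phi>. C x) = n"
    unfolding n_def C_def using card_fibres[OF assms(1), of X] by simp
  also have "(\<Sum>x\<in>X ` \<Phi>. C x * ln (C x)) = log_cls \<Phi> X"
    unfolding C_def log_cls_fibres[OF assms(1)] ..
  finally show ?thesis using n by (simp add: n_def)
qed

text \<open>
  The right-hand side is \<open>card \<Phi>\<close> times the relative entropy of the joint law of \<open>(X, Y, Z)\<close> with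
  respect to the product of its marginals, which charges violated triangles while the joint law does not.
\<close>

lemma violation_prob_le_information:
  fixes X Y Z :: "'a \<Rightarrow> nat"
  assumes fin: "finite \<Phi>" "\<Phi> \<noteq> {}" "finite A" and img: "X ` \<Phi> \<subseteq> A" "Y ` \<Phi> \<subseteq> A" "Z ` \<Phi> \<subseteq> A"
    and tri: "\<And>\<omega>. \<omega> \<in> \<Phi> \<Longrightarrow> \<not> tri_violated (X \<omega>) (Y \<omega>) (Z \<omega>)"
  shows "card \<Phi> * violation_prob A (empirical \<Phi> X) (empirical \<Phi> Y) (empirical \<Phi> Z)
    \<le> log_cls \<Phi> (\<lambda>\<omega>. (X \<omega>, Y \<omega>, Z \<omega>)) + 2 * (card \<Phi> * ln (card \<Phi>)) - log_cls \<Phi> X - log_cls \<Phi> Y - log_cls \<Phi> Z"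
proof -
  define n where "n = real (card \<Phi>)"
  have n: "n > 0" unfolding n_def using fin by (simp add: card_gt_0_iff)
  define c where "c \<omega> = real (card {\<omega>'\<in>\<Phi>. X \<omega>' = X \<omega>})" for \<omega>
  define d where "d \<omega> = real (card {\<omega>'\<in>\<Phi>. Y \<omega>' = Y \<omega>})" for \<omega>
  define e where "e \<omega> = real (card {\<omega>'\<in>\<Phi>. Z \<omega>' = Z \<omega>})" for \<omega>
  define f where "f \<omega> = real (card {\<omega>'\<in>\<Phi>. (X \<omega>', Y \<omega>', Z \<omega>') = (X \<omega>, Y \<omega>, Z \<omega>)})" for \<omega>
  define P where "P = empirical \<Phi> X"
  define Q where "Q = empirical \<Phi> Y"
  define R where "R = empirical \<Phi> Z"
  have nonneg: "0 \<le> P x" "0 \<le> Q x" "0 \<le> R x" for x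
    by (simp_all add: P_def Q_def R_def empirical_nonneg)
  have one: "sum P A = 1" "sum Q A = 1" "sum R A = 1"
    unfolding P_def Q_def R_def using fin img by (simp_all add: sum_empirical)
  have pos: "c \<omega> > 0" "d \<omega> > 0" "e \<omega> > 0" "f \<omega> > 0" if "\<omega> \<in> \<Phi>" for \<omega>
    using card_cls_pos[OF fin(1) that, of X] card_cls_pos[OF fin(1) that, of Y]
      card_cls_pos[OF fin(1) that, of Z] card_cls_pos[OF fin(1) that, of "\<lambda>\<omega>. (X \<omega>, Y \<omega>, Z \<omega>)"]
    unfolding c_def d_def e_def f_def by auto
  have "ln (c \<omega>) + ln (d \<omega>) + ln (e \<omega>) - 2 * ln n - ln (f \<omega>)
      \<le> n * (P (X \<omega>) * Q (Y \<omega>) * R (Z \<omega>) / f \<omega>) - 1" if "\<omega> \<in> \<Phi>" for \<omega>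
  proof -
    have "ln (c \<omega> * d \<omega> * e \<omega> / f \<omega> / (n * n)) \<le> c \<omega> * d \<omega> * e \<omega> / f \<omega> / (n * n) - 1"
      using pos[OF that] n by (intro ln_le_minus_one) simp
    moreover have "c \<omega> * d \<omega> * e \<omega> / f \<omega> / (n * n) = n * (P (X \<omega>) * Q (Y \<omega>) * R (Z \<omega>) / f \<omega>)"
      using n by (simp add: P_def Q_def R_def empirical_def c_def d_def e_def n_def mult_ac)
    ultimately show ?thesis using pos[OF that] n by (simp add: ln_mult ln_div)
  qed
  then have "(\<Sum>\<omega>\<in>\<Phi>. ln (c \<omega>) + ln (d \<omega>) + ln (e \<omega>) - 2 * ln n - ln (f \<omega>))
      \<le> (\<Sum>\<omega>\<in>\<Phi>. n * (P (X \<omega>) * Q (Y \<omega>) * R (Z \<omega>) / f \<omega>) - 1)"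
    by (rule sum_mono)
  also have "\<dots> = n * (\<Sum>\<omega>\<in>\<Phi>. P (X \<omega>) * Q (Y \<omega>) * R (Z \<omega>) / f \<omega>) - n"
    by (simp add: sum_subtractf n_def sum_distrib_left)
  also have "(\<Sum>\<omega>\<in>\<Phi>. P (X \<omega>) * Q (Y \<omega>) * R (Z \<omega>) / f \<omega>)
      = (\<Sum>(x, y, z)\<in>(\<lambda>\<omega>. (X \<omega>, Y \<omega>, Z \<omega>)) ` \<Phi>. P x * Q y * R z)"
    using sum_div_card_cls[OF fin(1), of "\<lambda>(x, y, z). P x * Q y * R z" "\<lambda>\<omega>. (X \<omega>, Y \<omega>, Z \<omega>)"]
    by (simp add: f_def)
  \<comment> \<open>No attained triple is violated, so the extra factor is free here. Once the sum
    is extended to all of \<open>A \<times> A \<times> A\<close>, it removes exactly the violation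
    probability from the total mass 1.\<close>
  also have "\<dots> = (\<Sum>(x, y, z)\<in>(\<lambda>\<omega>. (X \<omega>, Y \<omega>, Z \<omega>)) ` \<Phi>. (1 - of_bool (tri_violated x y z)) * (P x * Q y * R z))"
    using tri by (intro sum.cong) auto
  also have "\<dots> \<le> (\<Sum>(x, y, z)\<in>A \<times> A \<times> A. (1 - of_bool (tri_violated x y z)) * (P x * Q y * R z))"
    using fin img nonneg by (intro sum_mono2) (auto intro!: mult_nonneg_nonneg)
  also have "\<dots> = (\<Sum>x\<in>A. \<Sum>y\<in>A. \<Sum>z\<in>A. (1 - of_bool (tri_violated x y z)) * (P x * Q y * R z))"
    by (simp add: sum.cartesian_product)
  also have "\<dots> = (\<Sum>x\<in>A. \<Sum>y\<in>A. \<Sum>z\<in>A. P x * Q y * R z) - violation_prob A P Q R"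
    unfolding violation_prob_def sum_distrib_left sum_subtractf[symmetric]
    by (intro sum.cong refl) (simp add: algebra_simps)
  also have "(\<Sum>x\<in>A. \<Sum>y\<in>A. \<Sum>z\<in>A. P x * Q y * R z) = 1"
    using one by (simp flip: sum_distrib_left sum_distrib_right)
  finally have "(\<Sum>\<omega>\<in>\<Phi>. ln (c \<omega>) + ln (d \<omega>) + ln (e \<omega>) - 2 * ln n - ln (f \<omega>))
      \<le> n * (1 - violation_prob A P Q R) - n"
    using n by simp
  then show ?thesis
    by (simp add: sum_subtractf sum.distrib log_cls_def c_def d_def e_def f_def n_def P_def Q_def R_def
        algebra_simps)
qed

text \<open>\<open>shannon_triangle\<close> is applied to the empirical marginals as if they were
  independent; its violation term is paid for by the information of the true joint law.\<close>

lemma log_cls_triangle: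
  fixes X Y Z :: "'a \<Rightarrow> nat" and N :: nat and p :: real
  assumes fin: "finite \<Phi>" "\<Phi> \<noteq> {}" and N: "N \<ge> 1"
    and img: "X ` \<Phi> \<subseteq> {1..2*N}" "Y ` \<Phi> \<subseteq> {1..2*N}" "Z ` \<Phi> \<subseteq> {1..2*N}"
    and tri: "\<And>\<omega>. \<omega> \<in> \<Phi> \<Longrightarrow> \<not> tri_violated (X \<omega>) (Y \<omega>) (Z \<omega>)" and p: "0 < p"
  shows "3 * (card \<Phi> * ln (card \<Phi>)) - log_cls \<Phi> X - log_cls \<Phi> Y - log_cls \<Phi> Z
    \<le> card \<Phi> * (3 * ln N + 12 * p + 4 / N)
      + 30 / p^2 * (log_cls \<Phi> (\<lambda>\<omega>. (X \<omega>, Y \<omega>, Z \<omega>)) + 2 * (card \<Phi> * ln (card \<Phi>))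
        - log_cls \<Phi> X - log_cls \<Phi> Y - log_cls \<Phi> Z)" (is "_ \<le> ?a + _ * ?I")
proof -
  let ?q = "violation_prob {1..2*N} (empirical \<Phi> X) (empirical \<Phi> Y) (empirical \<Phi> Z)"
  let ?H = "shannon {1..2*N}"
  have "real (card \<Phi>) * (?H (empirical \<Phi> X) + ?H (empirical \<Phi> Y) + ?H (empirical \<Phi> Z))
      \<le> card \<Phi> * (3 * ln N + 12 * p + 30 * (?q / p^2) + 4 / N)"
    using fin img by (intro mult_left_mono shannon_triangle[OF N _ _ _ _ _ _ p])
      (auto simp: empirical_nonneg sum_empirical)
  moreover have "30 / p^2 * (card \<Phi> * ?q) \<le> 30 / p^2 * ?I"
    using violation_prob_le_information[OF fin finite_atLeastAtMost img tri]
    by (intro mult_left_mono) auto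
  ultimately show ?thesis
    using shannon_empirical[OF fin finite_atLeastAtMost img(1)] shannon_empirical[OF fin finite_atLeastAtMost img(2)]
      shannon_empirical[OF fin finite_atLeastAtMost img(3)]
    by (simp add: algebra_simps)
qed

text \<open>Thanks to the free parameter \<open>p\<close> the triangle bound is linear in the
  information. It can therefore be summed over the fibres of \<open>F\<close> with one common
  \<open>p\<close>, and no convexity argument is required.\<close>

lemma log_cls_triangle_cond:
  fixes X Y Z :: "'a \<Rightarrow> nat" and N :: nat and p :: real
  assumes fin: "finite \<Omega>" and N: "N \<ge> 1"
    and img: "X ` \<Omega> \<subseteq> {1..2*N}" "Y ` \<Omega> \<subseteq> {1..2*N}" "Z ` \<Omega> \<subseteq> {1..2*N}"
    and tri: "\<And>\<omega>. \<omega> \<in> \<Omega> \<Longrightarrow> \<not> tri_violated (X \<omega>) (Y \<omega>) (Z \<omega>)" and p: "0 < p"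
  shows "3 * log_cls \<Omega> F - log_cls \<Omega> (\<lambda>\<omega>. (F \<omega>, X \<omega>)) - log_cls \<Omega> (\<lambda>\<omega>. (F \<omega>, Y \<omega>)) - log_cls \<Omega> (\<lambda>\<omega>. (F \<omega>, Z \<omega>))
    \<le> card \<Omega> * (3 * ln N + 12 * p + 4 / N)
      + 30 / p^2 * (log_cls \<Omega> (\<lambda>\<omega>. (F \<omega>, X \<omega>, Y \<omega>, Z \<omega>)) + 2 * log_cls \<Omega> F
        - log_cls \<Omega> (\<lambda>\<omega>. (F \<omega>, X \<omega>)) - log_cls \<Omega> (\<lambda>\<omega>. (F \<omega>, Y \<omega>)) - log_cls \<Omega> (\<lambda>\<omega>. (F \<omega>, Z \<omega>)))"
  unfolding log_cls_pair_fibres[OF fin] log_cls_fibres[OF fin, of F] card_fibres[OF fin, of F]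
    sum_distrib_left sum_distrib_right sum_subtractf[symmetric] sum.distrib[symmetric]
proof (rule sum_mono)
  fix k assume k: "k \<in> F ` \<Omega>"
  show "3 * (real (card {\<omega> \<in> \<Omega>. F \<omega> = k}) * ln (real (card {\<omega> \<in> \<Omega>. F \<omega> = k})))
      - log_cls {\<omega> \<in> \<Omega>. F \<omega> = k} X - log_cls {\<omega> \<in> \<Omega>. F \<omega> = k} Y - log_cls {\<omega> \<in> \<Omega>. F \<omega> = k} Z
    \<le> real (card {\<omega> \<in> \<Omega>. F \<omega> = k}) * (3 * ln N + 12 * p + 4 / N)
      + 30 / p^2 * (log_cls {\<omega> \<in> \<Omega>. F \<omega> = k} (\<lambda>\<omega>. (X \<omega>, Y \<omega>, Z \<omega>))
        + 2 * (real (card {\<omega> \<in> \<Omega>. F \<omega> = k}) * ln (real (card {\<omega> \<in> \<Omega>. F \<omega> = k})))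
        - log_cls {\<omega> \<in> \<Omega>. F \<omega> = k} X - log_cls {\<omega> \<in> \<Omega>. F \<omega> = k} Y - log_cls {\<omega> \<in> \<Omega>. F \<omega> = k} Z)"
    by (rule log_cls_triangle) (use fin N img tri p k in auto)
qed

lemma log_cls_cond_le:
  assumes fin: "finite \<Omega>" "finite A" and img: "X ` \<Omega> \<subseteq> A"
  shows "log_cls \<Omega> F - log_cls \<Omega> (\<lambda>\<omega>. (F \<omega>, X \<omega>)) \<le> card \<Omega> * ln (card A)"
  unfolding log_cls_pair_fibres[OF fin(1)] log_cls_fibres[OF fin(1), of F] card_fibres[OF fin(1), of F]
    sum_distrib_right sum_subtractf[symmetric]
proof (rule sum_mono)
  fix k assume "k \<in> F ` \<Omega>"
  then have 1: "finite {\<omega> \<in> \<Omega>. F \<omega> = k}" "{\<omega> \<in> \<Omega>. F \<omega> = k} \<noteq> {}" "X ` {\<omega> \<in> \<Omega>. F \<omega> = k} \<subseteq> A"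
    using fin img by auto
  then have "A \<noteq> {}" by auto
  with 1 fin(2) have "shannon A (empirical {\<omega> \<in> \<Omega>. F \<omega> = k} X) \<le> ln (card A)"
    by (intro shannon_le_ln_card) (auto simp: empirical_nonneg sum_empirical)
  then show "real (card {\<omega> \<in> \<Omega>. F \<omega> = k}) * ln (real (card {\<omega> \<in> \<Omega>. F \<omega> = k})) - log_cls {\<omega> \<in> \<Omega>. F \<omega> = k} X
      \<le> real (card {\<omega> \<in> \<Omega>. F \<omega> = k}) * ln (card A)"
    unfolding shannon_empirical[OF 1(1,2) fin(2) 1(3), symmetric] by (intro mult_left_mono) auto
qed

subsection \<open>Integer metrics\<close>

lemma log_cls_bij:
  assumes \<phi>: "bij_betw \<phi> \<Omega> \<Omega>"
  shows "log_cls \<Omega> (\<lambda>\<omega>. K (\<phi> \<omega>)) = log_cls \<Omega> K"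
proof -
  have "card {\<omega>'\<in>\<Omega>. K (\<phi> \<omega>') = K (\<phi> \<omega>)} = card {\<omega>'\<in>\<Omega>. K \<omega>' = K (\<phi> \<omega>)}" for \<omega>
  proof (rule bij_betw_same_card[of \<phi>])
    show "bij_betw \<phi> {\<omega>'\<in>\<Omega>. K (\<phi> \<omega>') = K (\<phi> \<omega>)} {\<omega>'\<in>\<Omega>. K \<omega>' = K (\<phi> \<omega>)}"
      using \<phi> unfolding bij_betw_def inj_on_def by auto
  qed
  then show ?thesis
    unfolding log_cls_def
    using sum.reindex_bij_betw[OF \<phi>, of "\<lambda>\<omega>. ln (card {\<omega>'\<in>\<Omega>. K \<omega>' = K \<omega>})"] by simp
qed

definition int_metrics :: "nat \<Rightarrow> nat \<Rightarrow> (nat set \<Rightarrow> nat) set" where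
  "int_metrics N n = {w \<in> nsets {1..n} 2 \<rightarrow>\<^sub>E {1..2*N}.
     \<forall>i\<in>{1..n}. \<forall>j\<in>{1..n}. \<forall>k\<in>{1..n}. i \<noteq> j \<longrightarrow> i \<noteq> k \<longrightarrow> j \<noteq> k \<longrightarrow> w {i, j} \<le> w {i, k} + w {k, j}}"

lemma finite_int_metrics: "finite (int_metrics N n)"
  unfolding int_metrics_def using finite_PiE[OF finite_pairs[of n], of "\<lambda>_. {1..2*N}"] by auto

lemma int_metrics_nonempty:
  assumes "N \<ge> 1"
  shows "int_metrics N n \<noteq> {}"
proof -
  have "{i, j} \<in> nsets {1..n} 2" if "i \<in> {1..n}" "j \<in> {1..n}" "i \<noteq> j" for i j
    using that by simp
  then have "(\<lambda>e\<in>nsets {1..n} 2. 1) \<in> int_metrics N n"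
    using assms unfolding int_metrics_def by (auto simp del: doubleton_in_nsets_2)
  then show ?thesis by auto
qed

section \<open>Conditional entropies of edges in a random integer metric\<close>

definition edge_info :: "nat \<Rightarrow> nat \<Rightarrow> nat set set \<Rightarrow> real" where
  "edge_info N n S = log_cls (int_metrics N n) (\<lambda>w. restrict w S)"

lemma restrict_eq_iff: "restrict f S = restrict g S \<longleftrightarrow> (\<forall>x\<in>S. f x = g x)"
  by (auto simp: restrict_def fun_eq_iff)

lemma edge_info_eqI:
  assumes "\<And>w w'. K w' = K w \<longleftrightarrow> (\<forall>e\<in>S. w' e = w e)"
  shows "log_cls (int_metrics N n) K = edge_info N n S"
  unfolding edge_info_def by (rule log_cls_cong) (simp add: assms restrict_eq_iff)

text \<open>Conditioning on more edges cannot raise the entropy of the edges in \<open>S\<close>: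
  this is \<open>log_cls_submodular\<close>, where the restriction to \<open>G\<close> absorbs the
  one to \<open>F\<close>.\<close>

lemma edge_info_submodular:
  assumes "F \<subseteq> G"
  shows "edge_info N n G - edge_info N n (G \<union> S) \<le> edge_info N n F - edge_info N n (F \<union> S)"
proof -
  let ?L = "log_cls (int_metrics N n)"
  have "?L (\<lambda>w. (restrict w F, restrict w S)) = edge_info N n (F \<union> S)"
    by (rule edge_info_eqI) (auto simp: restrict_eq_iff)
  moreover have "?L (\<lambda>w. (restrict w F, restrict w G)) = edge_info N n G"
    by (rule edge_info_eqI) (use assms in \<open>auto simp: restrict_eq_iff\<close>)
  moreover have "?L (\<lambda>w. (restrict w F, restrict w S, restrict w G)) = edge_info N n (G \<union> S)"
    by (rule edge_info_eqI) (use assms in \<open>auto simp: restrict_eq_iff\<close>)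
  ultimately show ?thesis
    using log_cls_submodular[OF finite_int_metrics, of N n "\<lambda>w. restrict w F" "\<lambda>w. restrict w S" "\<lambda>w. restrict w G"]
    by (simp flip: edge_info_def)
qed

text \<open>Relabelling vertices permutes the integer metrics, so the uniform law is
  exchangeable.\<close>

lemma edge_info_image:
  assumes \<sigma>: "bij_betw \<sigma> {1..n} {1..n}" and S: "S \<subseteq> nsets {1..n} 2"
  shows "edge_info N n ((`) \<sigma> ` S) = edge_info N n S"
proof -
  let ?E = "nsets {1..n} 2" and ?\<Omega> = "int_metrics N n"
  define \<phi> where "\<phi> w = (\<lambda>e\<in>?E. w (\<sigma> ` e))" for w :: "nat set \<Rightarrow> nat"
  have E: "bij_betw ((`) \<sigma>) ?E ?E" using \<sigma> by (rule bij_betw_nsets)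
  have "\<phi> w \<in> ?\<Omega>" if w: "w \<in> ?\<Omega>" for w
  proof -
    have "\<phi> w {i, j} \<le> \<phi> w {i, k} + \<phi> w {k, j}"
      if "i \<in> {1..n}" "j \<in> {1..n}" "k \<in> {1..n}" "i \<noteq> j" "i \<noteq> k" "j \<noteq> k" for i j k
    proof -
      have "\<sigma> i \<in> {1..n}" "\<sigma> j \<in> {1..n}" "\<sigma> k \<in> {1..n}" using \<sigma> that bij_betwE by blast+
      moreover have "\<sigma> i \<noteq> \<sigma> j" "\<sigma> i \<noteq> \<sigma> k" "\<sigma> j \<noteq> \<sigma> k"
        using \<sigma> that unfolding bij_betw_def inj_on_def by blast+
      ultimately show ?thesis using w that unfolding int_metrics_def \<phi>_def by simp
    qed
    moreover have "w (\<sigma> ` e) \<in> {1..2*N}" if "e \<in> ?E" for e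
      using w E that bij_betwE unfolding int_metrics_def by blast
    ultimately show ?thesis unfolding int_metrics_def by (auto simp: \<phi>_def)
  qed
  moreover have "inj_on \<phi> ?\<Omega>"
  proof (rule inj_onI)
    fix w w' assume w: "w \<in> ?\<Omega>" "w' \<in> ?\<Omega>" "\<phi> w = \<phi> w'"
    have "w e = w' e" if "e \<in> ?E" for e
    proof -
      from E that obtain e' where "e' \<in> ?E" "e = \<sigma> ` e'" unfolding bij_betw_def by blast
      with fun_cong[OF w(3), of e'] show ?thesis by (simp add: \<phi>_def)
    qed
    with w show "w = w'" unfolding int_metrics_def by (auto intro: PiE_ext)
  qed
  ultimately have "bij_betw \<phi> ?\<Omega> ?\<Omega>"
    using endo_inj_surj[OF finite_int_metrics, of \<phi> N n] by (simp add: bij_betw_def image_subset_iff)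
  then have "log_cls ?\<Omega> (\<lambda>w. restrict (\<phi> w) S) = edge_info N n S"
    unfolding edge_info_def by (rule log_cls_bij)
  moreover have "log_cls ?\<Omega> (\<lambda>w. restrict (\<phi> w) S) = edge_info N n ((`) \<sigma> ` S)"
    by (rule edge_info_eqI) (use S in \<open>auto simp: restrict_eq_iff \<phi>_def subset_iff\<close>)
  ultimately show ?thesis by simp
qed

definition star :: "nat \<Rightarrow> nat set \<Rightarrow> nat set set" where
  "star n T = {e \<in> nsets {1..n} 2. e \<inter> T \<noteq> {}}"

text \<open>
  \<open>gain N n k / card (int_metrics N n)\<close> is the entropy of one edge, conditioned on all edges that meet
  a given set of \<open>k\<close> vertices not containing its endpoints.
\<close>

definition gain :: "nat \<Rightarrow> nat \<Rightarrow> nat \<Rightarrow> real" where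
  "gain N n k = edge_info N n (star n {1..k}) - edge_info N n (star n {1..k} \<union> {{k+1, k+2}})"

text \<open>A permutation of the vertices carries \<open>T\<close> to \<open>{1..k}\<close> and
  \<open>i\<close>, \<open>j\<close> to \<open>k + 1\<close>, \<open>k + 2\<close>, hence the star
  of \<open>T\<close> to the star of \<open>{1..k}\<close>.\<close>

lemma gain_eq:
  assumes T: "T \<subseteq> {1..n}" and ij: "i \<in> {1..n} - T" "j \<in> {1..n} - T" "i \<noteq> j"
  shows "edge_info N n (star n T) - edge_info N n (star n T \<union> {{i, j}}) = gain N n (card T)"
proof -
  define k where "k = card T"
  have fin: "finite T" by (rule finite_subset[OF T]) simp
  have "card (T \<union> {i, j}) = k + 2" using fin ij by (simp add: k_def)
  moreover have "card (T \<union> {i, j}) \<le> card {1..n}" using T ij by (intro card_mono) auto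
  ultimately have k: "k + 2 \<le> n" by simp
  have "\<exists>f. bij_betw f T {1..k}"
    by (rule finite_same_card_bij) (simp_all add: fin k_def)
  then obtain f where f: "bij_betw f T {1..k}" ..
  have "card ({1..n} - (T \<union> {i, j})) = card {k+3..n}"
    using T ij fin k \<open>card (T \<union> {i, j}) = k + 2\<close> by (subst card_Diff_subset) auto
  then have "\<exists>g. bij_betw g ({1..n} - (T \<union> {i, j})) {k+3..n}"
    by (intro finite_same_card_bij) simp_all
  then obtain g where g: "bij_betw g ({1..n} - (T \<union> {i, j})) {k+3..n}" ..
  define \<sigma> where "\<sigma> x = (if x \<in> T then f x else if x = i then k + 1 else if x = j then k + 2 else g x)" for x
  have 1: "bij_betw \<sigma> T {1..k}" using f by (rule iffD1[OF bij_betw_cong, rotated]) (simp add: \<sigma>_def)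
  have 2: "bij_betw \<sigma> {i, j} {k+1, k+2}" using ij by (auto simp: bij_betw_def \<sigma>_def)
  have 3: "bij_betw \<sigma> ({1..n} - (T \<union> {i, j})) {k+3..n}"
    using g by (rule iffD1[OF bij_betw_cong, rotated]) (auto simp: \<sigma>_def)
  have 4: "bij_betw \<sigma> (T \<union> {i, j}) ({1..k} \<union> {k+1, k+2})" by (rule bij_betw_combine[OF 1 2]) auto
  have "bij_betw \<sigma> (T \<union> {i, j} \<union> ({1..n} - (T \<union> {i, j}))) ({1..k} \<union> {k+1, k+2} \<union> {k+3..n})"
    by (rule bij_betw_combine[OF 4 3]) auto
  moreover have "T \<union> {i, j} \<union> ({1..n} - (T \<union> {i, j})) = {1..n}" using T ij by auto
  moreover have "{1..k} \<union> {k+1, k+2} \<union> {k+3..n} = {1..n}" using k by auto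
  ultimately have \<sigma>: "bij_betw \<sigma> {1..n} {1..n}" by simp
  have "(`) \<sigma> ` star n T = star n {1..k}"
  proof -
    have iff: "\<sigma> ` e \<inter> {1..k} \<noteq> {} \<longleftrightarrow> e \<inter> T \<noteq> {}" if "e \<in> nsets {1..n} 2" for e
    proof -
      have e: "e \<subseteq> {1..n}" using that by (auto simp: nsets_def)
      have "\<sigma> ` e \<inter> \<sigma> ` T = \<sigma> ` (e \<inter> T)"
        using \<sigma> e T by (intro inj_on_image_Int[symmetric]) (auto simp: bij_betw_def)
      moreover have "\<sigma> ` T = {1..k}" using 1 by (simp add: bij_betw_def)
      ultimately show ?thesis by auto
    qed
    have E: "(`) \<sigma> ` nsets {1..n} 2 = nsets {1..n} 2" using bij_betw_nsets[OF \<sigma>] by (simp add: bij_betw_def)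
    show ?thesis
    proof (intro equalityI subsetI)
      fix e assume "e \<in> (`) \<sigma> ` star n T"
      then obtain e' where e': "e' \<in> nsets {1..n} 2" "e' \<inter> T \<noteq> {}" "e = \<sigma> ` e'" unfolding star_def by blast
      moreover from this have "e \<in> nsets {1..n} 2" using E by blast
      ultimately show "e \<in> star n {1..k}" using iff[of e'] unfolding star_def by simp
    next
      fix e assume e: "e \<in> star n {1..k}"
      then obtain e' where e': "e' \<in> nsets {1..n} 2" "e = \<sigma> ` e'" using E unfolding star_def by blast
      then have "e' \<in> star n T" using e iff[of e'] unfolding star_def by simp
      then show "e \<in> (`) \<sigma> ` star n T" using e'(2) by blast
    qed
  qed
  moreover have "\<sigma> ` {i, j} = {k+1, k+2}" using 2 by (simp add: bij_betw_def)
  moreover have "star n T \<union> {{i, j}} \<subseteq> nsets {1..n} 2" using ij by (auto simp: star_def)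
  ultimately show ?thesis
    using edge_info_image[OF \<sigma>, of "star n T"] edge_info_image[OF \<sigma>, of "star n T \<union> {{i, j}}"]
    by (simp add: gain_def k_def[symmetric])
qed

text \<open>The edge \<open>{k+2, k+3}\<close> avoids both \<open>{1..k}\<close> and
  \<open>{1..Suc k}\<close>, so both gains are entropies of this one edge, the second under stronger
  conditioning.\<close>

lemma gain_antimono:
  assumes "k + 3 \<le> n"
  shows "gain N n (Suc k) \<le> gain N n k"
proof -
  have "star n {1..k} \<subseteq> star n {1..Suc k}" by (auto simp: star_def)
  then show ?thesis
    using edge_info_submodular[of "star n {1..k}" "star n {1..Suc k}" N n "{{k+2, k+3}}"]
      gain_eq[of "{1..k}" n "k+2" "k+3" N] gain_eq[of "{1..Suc k}" n "k+2" "k+3" N] assms by simp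
qed

text \<open>\<open>log_cls_triangle_cond\<close> is applied to a triangle outside
  \<open>{1..k}\<close>, given the star of \<open>{1..k}\<close>. Expanding its joint entropy by the
  chain rule gives one edge of entropy \<open>gain N n k\<close> and two of at least
  \<open>gain N n (Suc k)\<close>, so the information is at most twice their difference.\<close>

lemma gain_recursion:
  assumes N: "N \<ge> 1" and k: "k + 3 \<le> n" and p: "0 < p"
  shows "3 * gain N n k \<le> card (int_metrics N n) * (3 * ln N + 12 * p + 4 / N)
    + 60 / p^2 * (gain N n k - gain N n (Suc k))"
proof -
  let ?\<Omega> = "int_metrics N n" and ?S = "star n {1..k}" and ?L = "edge_info N n"
  define x y z where "x = k + 1" and "y = k + 2" and "z = k + 3"
  have xyz: "x \<in> {1..n}" "y \<in> {1..n}" "z \<in> {1..n}" "x \<noteq> y" "y \<noteq> z" "z \<noteq> x"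
    "x \<notin> {1..k}" "y \<notin> {1..k}" "z \<notin> {1..k}"
    using k by (auto simp: x_def y_def z_def)
  have E: "{x, y} \<in> nsets {1..n} 2" "{y, z} \<in> nsets {1..n} 2" "{z, x} \<in> nsets {1..n} 2"
    using xyz by auto
  have tri: "\<not> tri_violated (w {x, y}) (w {y, z}) (w {z, x})" if "w \<in> ?\<Omega>" for w
  proof -
    have w: "w {a, b} \<le> w {a, c} + w {c, b}" if "a \<in> {1..n}" "b \<in> {1..n}" "c \<in> {1..n}" "a \<noteq> b" "a \<noteq> c" "b \<noteq> c" for a b c
      using \<open>w \<in> ?\<Omega>\<close> that by (auto simp: int_metrics_def)
    show ?thesis
      using w[of x y z] w[of y z x] w[of z x y] xyz by (auto simp: tri_violated_def insert_commute)
  qed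
  have img: "(\<lambda>w. w e) ` ?\<Omega> \<subseteq> {1..2*N}" if "e \<in> nsets {1..n} 2" for e
    using that unfolding int_metrics_def by blast
  have g: "?L ?S - ?L (?S \<union> {{x, y}}) = gain N n k" "?L ?S - ?L (?S \<union> {{y, z}}) = gain N n k"
    "?L ?S - ?L (?S \<union> {{z, x}}) = gain N n k"
    using gain_eq[of "{1..k}" n x y N] gain_eq[of "{1..k}" n y z N] gain_eq[of "{1..k}" n z x N] xyz k
    by simp_all
  \<comment> \<open>All conditioning edges meet \<open>{1..k}\<close> or \<open>x\<close>, while
    \<open>{y, z}\<close> does not. In the next estimate \<open>y\<close> takes the role of
    \<open>x\<close>: both known triangle edges contain it and \<open>{z, x}\<close> avoids
    it.\<close>
  have "gain N n (Suc k) \<le> ?L (?S \<union> {{x, y}}) - ?L (?S \<union> {{x, y}} \<union> {{y, z}})"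
  proof -
    have "gain N n (card ({1..k} \<union> {x})) = ?L (star n ({1..k} \<union> {x})) - ?L (star n ({1..k} \<union> {x}) \<union> {{y, z}})"
      using xyz k by (intro gain_eq[symmetric]) auto
    also have "\<dots> \<le> ?L (?S \<union> {{x, y}}) - ?L (?S \<union> {{x, y}} \<union> {{y, z}})"
      using E by (intro edge_info_submodular) (auto simp: star_def)
    finally show ?thesis using xyz by simp
  qed
  moreover have "gain N n (Suc k) \<le> ?L (?S \<union> {{x, y}} \<union> {{y, z}}) - ?L (?S \<union> {{x, y}} \<union> {{y, z}} \<union> {{z, x}})"
  proof -
    have "gain N n (card ({1..k} \<union> {y})) = ?L (star n ({1..k} \<union> {y})) - ?L (star n ({1..k} \<union> {y}) \<union> {{z, x}})"
      using xyz k by (intro gain_eq[symmetric]) auto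
    also have "\<dots> \<le> ?L (?S \<union> {{x, y}} \<union> {{y, z}}) - ?L (?S \<union> {{x, y}} \<union> {{y, z}} \<union> {{z, x}})"
      using E by (intro edge_info_submodular) (auto simp: star_def)
    finally show ?thesis using xyz by simp
  qed
  ultimately have I: "?L (?S \<union> {{x, y}} \<union> {{y, z}} \<union> {{z, x}}) + 2 * ?L ?S
      - ?L (?S \<union> {{x, y}}) - ?L (?S \<union> {{y, z}}) - ?L (?S \<union> {{z, x}}) \<le> 2 * (gain N n k - gain N n (Suc k))"
    using g by argo
  have L: "log_cls ?\<Omega> (\<lambda>w. (restrict w ?S, w {x, y})) = ?L (?S \<union> {{x, y}})"
    "log_cls ?\<Omega> (\<lambda>w. (restrict w ?S, w {y, z})) = ?L (?S \<union> {{y, z}})"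
    "log_cls ?\<Omega> (\<lambda>w. (restrict w ?S, w {z, x})) = ?L (?S \<union> {{z, x}})"
    "log_cls ?\<Omega> (\<lambda>w. (restrict w ?S, w {x, y}, w {y, z}, w {z, x})) = ?L (?S \<union> {{x, y}} \<union> {{y, z}} \<union> {{z, x}})"
    by (rule edge_info_eqI; auto simp: restrict_eq_iff)+
  have "3 * gain N n k = 3 * ?L ?S - ?L (?S \<union> {{x, y}}) - ?L (?S \<union> {{y, z}}) - ?L (?S \<union> {{z, x}})"
    using g by linarith
  also have "\<dots> \<le> card ?\<Omega> * (3 * ln N + 12 * p + 4 / N)
      + 30 / p^2 * (?L (?S \<union> {{x, y}} \<union> {{y, z}} \<union> {{z, x}}) + 2 * ?L ?S
      - ?L (?S \<union> {{x, y}}) - ?L (?S \<union> {{y, z}}) - ?L (?S \<union> {{z, x}}))"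
    using log_cls_triangle_cond[OF finite_int_metrics N img[OF E(1)] img[OF E(2)] img[OF E(3)] tri p, of "\<lambda>w. restrict w ?S"]
    unfolding L by (simp flip: edge_info_def)
  also have "\<dots> \<le> card ?\<Omega> * (3 * ln N + 12 * p + 4 / N) + 30 / p^2 * (2 * (gain N n k - gain N n (Suc k)))"
    using I by (intro add_left_mono mult_left_mono) auto
  finally show ?thesis by simp
qed

lemma gain_0_le:
  assumes "2 \<le> n"
  shows "gain N n 0 \<le> card (int_metrics N n) * ln (2 * N)"
proof -
  have 1: "(\<lambda>w. w {1, 2}) ` int_metrics N n \<subseteq> {1..2*N}"
    using assms unfolding int_metrics_def by (auto dest!: PiE_mem[of _ _ _ "{1,2}"])
  have 2: "log_cls (int_metrics N n) (\<lambda>w. (restrict w (star n {1..0}), w {1, 2})) = edge_info N n (star n {1..0} \<union> {{1, 2}})"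
    by (rule edge_info_eqI) (auto simp: restrict_eq_iff)
  show ?thesis
    using log_cls_cond_le[OF finite_int_metrics _ 1, of "\<lambda>w. restrict w (star n {1..0})"]
    unfolding 2 by (simp add: gain_def numeral_2_eq_2 flip: edge_info_def)
qed

text \<open>
  Taking \<open>p = \<alpha> (k + 1) / 12\<close> in the recursion gives \<open>(\<alpha> (k + 1))^3 \<le> 8640 * (\<alpha> k - \<alpha> (k + 1))\<close>.
\<close>

lemma inverse_sqrt_decay:
  fixes \<alpha> :: "nat \<Rightarrow> real"
  assumes "n \<le> N" and \<alpha>0: "\<alpha> 0 \<le> 100"
    and mono: "\<And>k. k + 3 \<le> n \<Longrightarrow> \<alpha> (Suc k) \<le> \<alpha> k"
    and rec: "\<And>k p. k + 3 \<le> n \<Longrightarrow> 0 < p \<Longrightarrow>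
      3 * \<alpha> k \<le> 12 * p + 4 / real N + 60 / p^2 * (\<alpha> k - \<alpha> (Suc k))"
  shows "k + 2 \<le> n \<Longrightarrow> \<alpha> k \<le> 100 / sqrt (real k + 1)"
proof (induction k)
  case 0
  then show ?case using \<alpha>0 by simp
next
  case (Suc k)
  define x y u v where "x = \<alpha> k" and "y = \<alpha> (Suc k)" and "u = sqrt (real k + 1)" and "v = sqrt (real k + 2)"
  have x: "x \<le> 100 / u" using Suc by (simp add: x_def u_def)
  have yx: "y \<le> x" using mono[of k] Suc.prems by (simp add: x_def y_def)
  have u: "u \<ge> 1" "v > 0" "v ^ 2 = u ^ 2 + 1" "u \<le> v" by (auto simp: u_def v_def)
  show ?case
  proof (rule ccontr)
    assume "\<not> ?case"
    then have y: "y > 100 / v" by (simp add: y_def v_def add.commute)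
    then have y0: "y > 0" using u by (meson divide_pos_pos less_trans zero_less_numeral)
    have "v \<le> real k + 2" unfolding v_def by (rule real_le_lsqrt) (auto simp: power2_eq_square algebra_simps)
    also have "\<dots> \<le> N" using Suc.prems assms(1) by linarith
    finally have "4 / real N \<le> 4 / v" using u by (intro divide_left_mono) auto
    also have "\<dots> \<le> 100 / v" using u by (intro divide_right_mono) auto
    finally have N: "4 / real N \<le> y" using y by simp
    \<comment> \<open>With \<open>p = y / 12\<close> the first two summands are each at most
      \<open>y\<close>, the second because \<open>n \<le> N\<close>. As \<open>y \<le> x\<close>,
      one \<open>y\<close> is left over on the left; \<open>60 * 144 = 8640\<close>.\<close>
    have "3 * x \<le> 12 * (y / 12) + 4 / real N + 60 / (y / 12)^2 * (x - y)"
      unfolding x_def y_def by (rule rec) (use Suc.prems y0 in \<open>auto simp: y_def\<close>)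
    then have "y \<le> 60 / (y / 12)^2 * (x - y)" using N yx by linarith
    then have "y * y^2 \<le> 8640 * (x - y)" using y0 by (simp add: power_divide field_simps)
    then have y3: "y ^ 3 \<le> 8640 * (x - y)" by (simp add: power3_eq_cube power2_eq_square)
    have "v ^ 3 \<le> u * v * (u + v)"
    proof -
      have "1 \<le> u * v" using u mult_mono[of 1 u 1 v] by simp
      then have "v ^ 2 \<le> u * (u + v)" using u by (simp add: power2_eq_square algebra_simps)
      then have "v * v ^ 2 \<le> v * (u * (u + v))" using u by (intro mult_left_mono) auto
      then show ?thesis by (simp add: power3_eq_cube power2_eq_square mult_ac)
    qed
    \<comment> \<open>The sequence \<open>100 / sqrt (k + 1)\<close> drops by at most
      \<open>100 / v ^ 3\<close> in one step, so the contradiction comes from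
      \<open>8640 * 100 < 100 ^ 3\<close>.\<close>
    have "x - y < 100 / u - 100 / v" using x y by linarith
    also have "100 / u - 100 / v = 100 * (v - u) / (u * v)" using u by (simp add: field_simps)
    also have "v - u = 1 / (u + v)" using u by (simp add: field_simps power2_eq_square)
    also have "100 * (1 / (u + v)) / (u * v) = 100 / (u * v * (u + v))" by simp
    also have "\<dots> \<le> 100 / v ^ 3" using u \<open>v ^ 3 \<le> u * v * (u + v)\<close> by (intro divide_left_mono) auto
    finally have "8640 * (x - y) < 864000 / v ^ 3" by simp
    moreover have "(100 / v) ^ 3 \<le> y ^ 3" using y u by (intro power_mono) auto
    moreover have "(100 / v) ^ 3 = 1000000 / v ^ 3" by (simp add: power_divide)
    moreover have "864000 / v ^ 3 \<le> 1000000 / v ^ 3" using u by (intro divide_right_mono) auto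
    ultimately show False using y3 by linarith
  qed
qed

text \<open>\<open>\<alpha>\<close> is the entropy of an edge in excess of \<open>ln N\<close>. In
  this normalisation \<open>gain_recursion\<close> loses its \<open>ln N\<close> terms and becomes
  the hypothesis of \<open>inverse_sqrt_decay\<close>, and \<open>gain_0_le\<close> gives
  \<open>\<alpha> 0 \<le> ln 2\<close>.\<close>

lemma gain_le:
  assumes "1 \<le> N" "n \<le> N" "k + 2 \<le> n"
  shows "gain N n k \<le> card (int_metrics N n) * (ln N + 100 / sqrt (real k + 1))"
proof -
  define M where "M = real (card (int_metrics N n))"
  have M: "M > 0" unfolding M_def using int_metrics_nonempty[OF assms(1)] finite_int_metrics
    by (simp add: card_gt_0_iff)
  define \<alpha> where "\<alpha> k = gain N n k / M - ln N" for k
  have g: "gain N n k = M * (\<alpha> k + ln N)" for k using M by (simp add: \<alpha>_def)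
  have "\<alpha> k \<le> 100 / sqrt (real k + 1)"
  proof (rule inverse_sqrt_decay[OF assms(2) _ _ _ assms(3)])
    have "M * (\<alpha> 0 + ln N) \<le> M * (ln 2 + ln N)"
      using gain_0_le[of n N] assms unfolding g[of 0, symmetric] by (simp add: ln_mult M_def)
    then have "\<alpha> 0 \<le> ln 2" using M by simp
    then show "\<alpha> 0 \<le> 100" using ln2_le_25_over_36 by linarith
  next
    fix k assume "k + 3 \<le> n"
    then have "M * (\<alpha> (Suc k) + ln N) \<le> M * (\<alpha> k + ln N)" unfolding g[symmetric] by (rule gain_antimono)
    then show "\<alpha> (Suc k) \<le> \<alpha> k" using M by simp
  next
    fix k and p :: real assume k: "k + 3 \<le> n" and p: "0 < p"
    have "3 * (M * (\<alpha> k + ln N)) \<le> M * (3 * ln N + 12 * p + 4 / N) + 60 / p^2 * (M * (\<alpha> k + ln N) - M * (\<alpha> (Suc k) + ln N))"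
      using gain_recursion[OF assms(1) k p] unfolding g M_def[symmetric] .
    then have "M * (3 * \<alpha> k) \<le> M * (12 * p + 4 / N + 60 / p^2 * (\<alpha> k - \<alpha> (Suc k)))"
      by (simp add: algebra_simps)
    then show "3 * \<alpha> k \<le> 12 * p + 4 / N + 60 / p^2 * (\<alpha> k - \<alpha> (Suc k))" using M by simp
  qed
  then have "M * (\<alpha> k + ln N) \<le> M * (ln N + 100 / sqrt (real k + 1))" using M by (intro mult_left_mono) auto
  then show ?thesis unfolding g M_def by simp
qed

text \<open>Enlarging the star by the vertex \<open>k + 1\<close> reveals the edges from it to
  \<open>{k+2..n}\<close>. Revealed one after the other, each is conditioned on at least the star of
  \<open>{1..k}\<close> and so adds at most \<open>gain N n k\<close>.\<close>

lemma edge_info_star_step: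
  assumes "k + 1 \<le> n"
  shows "edge_info N n (star n {1..k}) - edge_info N n (star n {1..Suc k}) \<le> real (n - 1 - k) * gain N n k"
proof -
  let ?S = "star n {1..k}" and ?L = "edge_info N n"
  have "?L ?S - ?L (?S \<union> (\<lambda>j. {k+1, j}) ` J) \<le> real (card J) * gain N n k" if "finite J" "J \<subseteq> {k+2..n}" for J
    using that
  proof (induction J)
    case (insert j J)
    have "?L (?S \<union> (\<lambda>j. {k+1, j}) ` J) - ?L (?S \<union> (\<lambda>j. {k+1, j}) ` J \<union> {{k+1, j}}) \<le> ?L ?S - ?L (?S \<union> {{k+1, j}})"
      by (rule edge_info_submodular) auto
    also have "\<dots> = gain N n (card {1..k})" by (rule gain_eq) (use insert.prems in auto)
    finally show ?case using insert by (simp add: algebra_simps insert_commute)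
  qed simp
  from this[of "{k+2..n}"]
  have "?L ?S - ?L (?S \<union> (\<lambda>j. {k+1, j}) ` {k+2..n}) \<le> real (n - 1 - k) * gain N n k"
    by simp
  also have "?S \<union> (\<lambda>j. {k+1, j}) ` {k+2..n} = star n {1..Suc k}"
  proof (intro equalityI subsetI)
    fix e assume "e \<in> ?S \<union> (\<lambda>j. {k+1, j}) ` {k+2..n}"
    then show "e \<in> star n {1..Suc k}" using assms by (auto simp: star_def)
  next
    fix e assume e: "e \<in> star n {1..Suc k}"
    show "e \<in> ?S \<union> (\<lambda>j. {k+1, j}) ` {k+2..n}"
    proof (cases "e \<inter> {1..k} = {}")
      case True
      with e have k1: "Suc k \<in> e" "e \<in> nsets {1..n} 2" by (auto simp: star_def le_Suc_eq)
      then obtain a b where ab: "e = {a, b}" "a \<noteq> b" "a \<in> {1..n}" "b \<in> {1..n}" unfolding nsets_2_eq by blast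
      define j where "j = (if a = Suc k then b else a)"
      have "e = {Suc k, j}" "j \<noteq> Suc k" "j \<in> {1..n}" using k1 ab by (auto simp: j_def)
      moreover from this True have "j \<ge> k + 2" by auto
      ultimately show ?thesis by auto
    qed (use e in \<open>auto simp: star_def\<close>)
  qed
  finally show ?thesis .
qed

lemma sum_inverse_sqrt_le: "(\<Sum>k<n. 1 / sqrt (real k + 1)) \<le> 2 * sqrt n"
proof (induction n)
  case (Suc n)
  define u v where "u = sqrt n" and "v = sqrt (real n + 1)"
  have uv: "0 \<le> u" "u \<le> v" "v > 0" "v * v = u * u + 1" by (auto simp: u_def v_def)
  have "1 = (v - u) * (v + u)" using uv by (simp add: algebra_simps)
  also have "\<dots> \<le> (v - u) * (2 * v)" using uv by (intro mult_left_mono) auto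
  finally have "1 \<le> (2 * v - 2 * u) * v" by (simp add: algebra_simps)
  then have "1 / v \<le> 2 * v - 2 * u" unfolding pos_divide_le_eq[OF uv(3)] .
  then show ?case using Suc by (simp add: u_def v_def add.commute)
qed simp

lemma card_pairs: "card (nsets {1..n} 2) = n choose 2"
  by (simp add: card_nsets)

text \<open>The vertices are exposed one at a time. The empty star gives \<open>M * ln M\<close>,
  the full star determines the metric and gives 0, and the telescoped steps are bounded by
  \<open>gain_le\<close>.\<close>

lemma ln_card_int_metrics_le:
  assumes "1 \<le> N" "n \<le> N"
  shows "ln (card (int_metrics N n)) \<le> real (n choose 2) * ln N + 200 * real n * sqrt n"
proof -
  let ?\<Omega> = "int_metrics N n"
  define M where "M = real (card ?\<Omega>)"
  have M: "M > 0" unfolding M_def using int_metrics_nonempty[OF assms(1)] finite_int_metrics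
    by (simp add: card_gt_0_iff)
  have start: "edge_info N n (star n {1..0}) = M * ln M"
    by (simp add: edge_info_def star_def log_cls_def M_def restrict_def)
  have "edge_info N n (star n {1..n}) = 0"
  proof -
    have "{w'\<in>?\<Omega>. restrict w' (star n {1..n}) = restrict w (star n {1..n})} = {w}" if "w \<in> ?\<Omega>" for w
    proof -
      have "w' = w" if w': "w' \<in> ?\<Omega>" "restrict w' (star n {1..n}) = restrict w (star n {1..n})" for w'
      proof (rule PiE_ext)
        show "w' \<in> nsets {1..n} 2 \<rightarrow>\<^sub>E {1..2*N}" "w \<in> nsets {1..n} 2 \<rightarrow>\<^sub>E {1..2*N}"
          using w' \<open>w \<in> ?\<Omega>\<close> by (auto simp: int_metrics_def)
      next
        fix e assume "e \<in> nsets {1..n} 2"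
        moreover from this have "e \<subseteq> {1..n}" "e \<noteq> {}" by (auto simp: nsets_def)
        then have "e \<inter> {1..n} \<noteq> {}" by blast
        ultimately have "e \<in> star n {1..n}" by (simp add: star_def)
        then show "w' e = w e" using w'(2) unfolding restrict_eq_iff by blast
      qed
      with that show ?thesis by auto
    qed
    then show ?thesis by (simp add: edge_info_def log_cls_def)
  qed
  then have "M * ln M = (\<Sum>k<n. edge_info N n (star n {1..k}) - edge_info N n (star n {1..Suc k}))"
    using start by (subst sum_lessThan_telescope') simp
  also have "\<dots> \<le> (\<Sum>k<n. real (n - 1 - k) * (M * (ln N + 100 / sqrt (real k + 1))))"
  proof (rule sum_mono)
    fix k assume k: "k \<in> {..<n}"
    have "real (n - 1 - k) * gain N n k \<le> real (n - 1 - k) * (M * (ln N + 100 / sqrt (real k + 1)))"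
    proof (cases "k + 2 \<le> n")
      case True
      then show ?thesis using gain_le[OF assms, of k] unfolding M_def by (intro mult_left_mono) auto
    next
      case False
      then have "n - 1 - k = 0" by simp
      then show ?thesis by simp
    qed
    then show "edge_info N n (star n {1..k}) - edge_info N n (star n {1..Suc k})
        \<le> real (n - 1 - k) * (M * (ln N + 100 / sqrt (real k + 1)))"
      using edge_info_star_step[of k n N] k by simp
  qed
  also have "\<dots> = M * ((\<Sum>k<n. real (n - 1 - k)) * ln N + (\<Sum>k<n. real (n - 1 - k) * (100 / sqrt (real k + 1))))"
    by (simp add: sum_distrib_left sum_distrib_right sum.distrib[symmetric] algebra_simps)
  finally have "ln M \<le> (\<Sum>k<n. real (n - 1 - k)) * ln N + (\<Sum>k<n. real (n - 1 - k) * (100 / sqrt (real k + 1)))"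
    using M by simp
  also have "(\<Sum>k<n. real (n - 1 - k)) = real (n choose 2)"
  proof -
    have "(\<Sum>k<n. n - 1 - k) = (\<Sum>k<n. k)"
      by (rule sum.reindex_bij_witness[of _ "\<lambda>k. n - 1 - k" "\<lambda>k. n - 1 - k"]) auto
    also have "\<dots> = n choose 2"
      using gauss_sum_nat[of "n - 1"] by (cases n) (simp_all add: choose_two lessThan_Suc_atMost atLeast0AtMost mult.commute)
    finally show ?thesis by (metis of_nat_sum)
  qed
  also have "(\<Sum>k<n. real (n - 1 - k) * (100 / sqrt (real k + 1))) \<le> (\<Sum>k<n. real n * 100 * (1 / sqrt (real k + 1)))"
    by (intro sum_mono) (auto simp: field_simps)
  also have "\<dots> \<le> real n * 100 * (2 * sqrt n)"
    unfolding sum_distrib_left[symmetric] by (intro mult_left_mono sum_inverse_sqrt_le) auto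
  finally show ?thesis by (simp add: M_def)
qed

subsection \<open>The local lemma and triangles with small slack\<close>

lemma card_avoiding_insert:
  fixes B :: "'i \<Rightarrow> 'w set" and x :: real
  assumes "finite \<Omega>" and "real (card (B j \<inter> {\<omega>\<in>\<Omega>. \<forall>i\<in>S. \<omega> \<notin> B i})) \<le> x * card {\<omega>\<in>\<Omega>. \<forall>i\<in>S. \<omega> \<notin> B i}"
  shows "(1 - x) * card {\<omega>\<in>\<Omega>. \<forall>i\<in>S. \<omega> \<notin> B i} \<le> card {\<omega>\<in>\<Omega>. \<forall>i\<in>insert j S. \<omega> \<notin> B i}"
proof -
  let ?G = "{\<omega>\<in>\<Omega>. \<forall>i\<in>S. \<omega> \<notin> B i}"
  have "{\<omega>\<in>\<Omega>. \<forall>i\<in>insert j S. \<omega> \<notin> B i} = ?G - B j \<inter> ?G" by auto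
  moreover have "card (?G - B j \<inter> ?G) = card ?G - card (B j \<inter> ?G)"
    using assms(1) by (intro card_Diff_subset) auto
  moreover have "card (B j \<inter> ?G) \<le> card ?G" using assms(1) by (intro card_mono) auto
  ultimately show ?thesis using assms(2) by (simp add: algebra_simps of_nat_diff)
qed

text \<open>The induction of the symmetric Lovasz local lemma, with counts in place of
  probabilities. Independence controls the event given the non-neighbours \<open>T\<close>.
  Restoring the at most \<open>D\<close> neighbours one at a time keeps a fraction
  \<open>1 - x\<close> each time, by induction, since \<open>T \<union> J\<close> is smaller than
  \<open>S\<close>.\<close>

lemma local_lemma_step:
  fixes B :: "'i \<Rightarrow> 'w set" and p x :: real
  assumes fin: "finite \<Omega>" "finite I" and x: "0 \<le> x" "x < 1"
    and nbr: "\<And>i. i \<in> I \<Longrightarrow> card (\<Gamma> i) \<le> D \<and> finite (\<Gamma> i)" and p: "p \<le> x * (1 - x) ^ D"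
    and indep: "\<And>i S. i \<in> I \<Longrightarrow> S \<subseteq> I - \<Gamma> i \<Longrightarrow>
      real (card (B i \<inter> {\<omega>\<in>\<Omega>. \<forall>j\<in>S. \<omega> \<notin> B j})) \<le> p * card {\<omega>\<in>\<Omega>. \<forall>j\<in>S. \<omega> \<notin> B j}"
  shows "S \<subseteq> I \<Longrightarrow> i \<in> I \<Longrightarrow>
    real (card (B i \<inter> {\<omega>\<in>\<Omega>. \<forall>j\<in>S. \<omega> \<notin> B j})) \<le> x * card {\<omega>\<in>\<Omega>. \<forall>j\<in>S. \<omega> \<notin> B j}"
proof (induction "card S" arbitrary: S i rule: less_induct)
  case less
  define G where "G S = {\<omega>\<in>\<Omega>. \<forall>j\<in>S. \<omega> \<notin> B j}" for S
  have finS: "finite S" using less.prems fin finite_subset by blast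
  define T where "T = S - \<Gamma> i"
  have grow: "(1 - x) ^ card J * card (G T) \<le> card (G (T \<union> J))" if "finite J" "J \<subseteq> S \<inter> \<Gamma> i" for J
    using that
  proof (induction J)
    case (insert j J)
    have "card (T \<union> J) < card S" using insert finS unfolding T_def by (intro psubset_card_mono) auto
    then have "real (card (B j \<inter> G (T \<union> J))) \<le> x * card (G (T \<union> J))"
      unfolding G_def using insert.prems less.prems by (intro less.hyps) (auto simp: T_def)
    then have "(1 - x) * card (G (T \<union> J)) \<le> card (G (insert j (T \<union> J)))"
      unfolding G_def by (intro card_avoiding_insert[OF fin(1)])
    moreover have "(1 - x) * ((1 - x) ^ card J * card (G T)) \<le> (1 - x) * card (G (T \<union> J))"
      using insert x by (intro mult_left_mono) auto
    ultimately show ?case using insert by (simp add: mult.assoc)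
  qed simp
  have "real (card (B i \<inter> G S)) \<le> card (B i \<inter> G T)"
    using fin(1) by (intro of_nat_mono card_mono) (auto simp: G_def T_def)
  also have "\<dots> \<le> p * card (G T)"
    unfolding G_def using less.prems by (intro indep) (auto simp: T_def)
  also have "\<dots> \<le> (x * (1 - x) ^ card (S \<inter> \<Gamma> i)) * card (G T)"
  proof -
    have "card (S \<inter> \<Gamma> i) \<le> card (\<Gamma> i)" using nbr less.prems by (intro card_mono) auto
    then have "card (S \<inter> \<Gamma> i) \<le> D" using nbr[OF less.prems(2)] by simp
    then have "x * (1 - x) ^ D \<le> x * (1 - x) ^ card (S \<inter> \<Gamma> i)"
      using x by (intro mult_left_mono power_decreasing) auto
    with p show ?thesis by (intro mult_right_mono) auto
  qed
  also have "\<dots> \<le> x * card (G (T \<union> (S \<inter> \<Gamma> i)))"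
    using grow[of "S \<inter> \<Gamma> i"] finS x by (simp add: mult.assoc mult_left_mono)
  also have "T \<union> (S \<inter> \<Gamma> i) = S" by (auto simp: T_def)
  finally show ?case by (simp add: G_def)
qed

text \<open>By \<open>local_lemma_step\<close> each further event that has to be avoided costs at
  most a factor \<open>1 - x\<close>.\<close>

lemma local_lemma_counting:
  fixes B :: "'i \<Rightarrow> 'w set" and p x :: real
  assumes fin: "finite \<Omega>" "finite I" and x: "0 \<le> x" "x < 1"
    and nbr: "\<And>i. i \<in> I \<Longrightarrow> card (\<Gamma> i) \<le> D \<and> finite (\<Gamma> i)" and p: "p \<le> x * (1 - x) ^ D"
    and indep: "\<And>i S. i \<in> I \<Longrightarrow> S \<subseteq> I - \<Gamma> i \<Longrightarrow>
      real (card (B i \<inter> {\<omega>\<in>\<Omega>. \<forall>j\<in>S. \<omega> \<notin> B j})) \<le> p * card {\<omega>\<in>\<Omega>. \<forall>j\<in>S. \<omega> \<notin> B j}"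
  shows "(1 - x) ^ card I * card \<Omega> \<le> card {\<omega>\<in>\<Omega>. \<forall>j\<in>I. \<omega> \<notin> B j}"
proof -
  have "(1 - x) ^ card J * card \<Omega> \<le> card {\<omega>\<in>\<Omega>. \<forall>j\<in>J. \<omega> \<notin> B j}" if "finite J" "J \<subseteq> I" for J
    using that
  proof (induction J)
    case (insert j J)
    have "real (card (B j \<inter> {\<omega>\<in>\<Omega>. \<forall>i\<in>J. \<omega> \<notin> B i})) \<le> x * card {\<omega>\<in>\<Omega>. \<forall>i\<in>J. \<omega> \<notin> B i}"
      by (rule local_lemma_step[OF fin x nbr p indep]) (use insert.prems in auto)
    then have "(1 - x) * card {\<omega>\<in>\<Omega>. \<forall>i\<in>J. \<omega> \<notin> B i} \<le> card {\<omega>\<in>\<Omega>. \<forall>i\<in>insert j J. \<omega> \<notin> B i}"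
      by (rule card_avoiding_insert[OF fin(1)])
    moreover have "(1 - x) * ((1 - x) ^ card J * card \<Omega>) \<le> (1 - x) * card {\<omega>\<in>\<Omega>. \<forall>i\<in>J. \<omega> \<notin> B i}"
      using insert x by (intro mult_left_mono) auto
    ultimately show ?case using insert(1,2) by (simp add: mult.assoc)
  qed simp
  then show ?thesis using fin(2) by blast
qed

text \<open>Swapping the coordinates in \<open>S\<close> between two points is an involution of \<open>\<Omega> \<times> \<Omega>\<close> that exchanges
  \<open>(A \<inter> B) \<times> \<Omega>\<close> with \<open>A \<times> B\<close>.\<close>

lemma card_Int_PiE_independent:
  fixes E :: "'e set" and V :: "'v set"
  defines "\<Omega> \<equiv> E \<rightarrow>\<^sub>E V"
  assumes sub: "A \<subseteq> \<Omega>" "B \<subseteq> \<Omega>"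
    and A: "\<And>w w'. w \<in> A \<Longrightarrow> w' \<in> \<Omega> \<Longrightarrow> (\<And>e. e \<in> S \<Longrightarrow> w' e = w e) \<Longrightarrow> w' \<in> A"
    and B: "\<And>w w'. w \<in> B \<Longrightarrow> w' \<in> \<Omega> \<Longrightarrow> (\<And>e. e \<notin> S \<Longrightarrow> w' e = w e) \<Longrightarrow> w' \<in> B"
  shows "card (A \<inter> B) * card \<Omega> = card A * card B"
proof -
  define mix where "mix x y = (\<lambda>e. if e \<in> S then x e else y e)" for x y :: "'e \<Rightarrow> 'v"
  define f where "f = (\<lambda>(x, y). (mix x y, mix y x))"
  have mix: "mix x y \<in> \<Omega>" if "x \<in> \<Omega>" "y \<in> \<Omega>" for x y
    unfolding \<Omega>_def
  proof (rule PiE_I)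
    show "mix x y e \<in> V" if "e \<in> E" for e
      using PiE_mem[OF \<open>x \<in> \<Omega>\<close>[unfolded \<Omega>_def] that] PiE_mem[OF \<open>y \<in> \<Omega>\<close>[unfolded \<Omega>_def] that]
      by (simp add: mix_def)
    show "mix x y e = undefined" if "e \<notin> E" for e
      using PiE_arb[OF \<open>x \<in> \<Omega>\<close>[unfolded \<Omega>_def] that] PiE_arb[OF \<open>y \<in> \<Omega>\<close>[unfolded \<Omega>_def] that]
      by (simp add: mix_def)
  qed
  have mA: "mix x y \<in> A" if "x \<in> A" "y \<in> \<Omega>" for x y
    using A[OF that(1) mix[OF subsetD[OF sub(1) that(1)] that(2)]] by (simp add: mix_def)
  have mB: "mix x y \<in> B" if "x \<in> \<Omega>" "y \<in> B" for x y
    using B[OF that(2) mix[OF that(1) subsetD[OF sub(2) that(2)]]] by (simp add: mix_def)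
  have ff: "f (f z) = z" for z by (cases z) (auto simp: f_def mix_def fun_eq_iff)
  have "bij_betw f ((A \<inter> B) \<times> \<Omega>) (A \<times> B)"
  proof (rule bij_betw_byWitness[of _ f])
    show "f ` ((A \<inter> B) \<times> \<Omega>) \<subseteq> A \<times> B" using mA mB sub by (auto simp: f_def)
    show "f ` (A \<times> B) \<subseteq> (A \<inter> B) \<times> \<Omega>"
      using mA mB mix subsetD[OF sub(1)] subsetD[OF sub(2)] by (auto simp: f_def)
  qed (simp_all add: ff)
  then have "card ((A \<inter> B) \<times> \<Omega>) = card (A \<times> B)" by (rule bij_betw_same_card)
  then show ?thesis by (simp add: card_cartesian_product)
qed

section \<open>Counting grid points with a narrow triangle\<close>

lemma card_PiE_three_coordinates_le:
  assumes fin: "finite E" "finite V" and e: "e1 \<in> E" "e2 \<in> E" "e3 \<in> E" "e1 \<noteq> e2" "e1 \<noteq> e3" "e2 \<noteq> e3"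
  shows "card {w \<in> E \<rightarrow>\<^sub>E V. R (w e1) (w e2) (w e3)} * card V ^ 3
    \<le> card {(x, y, z) \<in> V \<times> V \<times> V. R x y z} * card (E \<rightarrow>\<^sub>E V)"
proof -
  let ?Q = "{(x, y, z) \<in> V \<times> V \<times> V. R x y z}"
  define F where "F = (\<lambda>(x, y, z).
    PiE E (\<lambda>e. if e = e1 then {x} else if e = e2 then {y} else if e = e3 then {z} else V))"
  have finQ: "finite ?Q" using fin by (intro finite_subset[of ?Q "V \<times> V \<times> V"]) auto
  have cardE: "card E = card (E - {e1, e2, e3}) + 3"
  proof -
    have "card (E - {e1, e2, e3}) = card E - card {e1, e2, e3}" using e by (intro card_Diff_subset) auto
    moreover have "card {e1, e2, e3} = 3" using e by simp
    moreover have "card {e1, e2, e3} \<le> card E" using e fin by (intro card_mono) auto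
    ultimately show ?thesis by simp
  qed
  have F: "card (F t) = card V ^ card (E - {e1, e2, e3})" for t
  proof -
    obtain x y z where t: "t = (x, y, z)" by (cases t)
    let ?T = "\<lambda>e. if e = e1 then {x} else if e = e2 then {y} else if e = e3 then {z} else V"
    have "card (F t) = (\<Prod>e\<in>E. card (?T e))" unfolding F_def t using fin(1) by (simp add: card_PiE)
    also have "\<dots> = (\<Prod>e\<in>E - {e1, e2, e3}. card (?T e)) * (\<Prod>e\<in>{e1, e2, e3}. card (?T e))"
      using e fin by (intro prod.subset_diff) auto
    also have "(\<Prod>e\<in>E - {e1, e2, e3}. card (?T e)) = (\<Prod>e\<in>E - {e1, e2, e3}. card V)"
      by (intro prod.cong) auto
    also have "(\<Prod>e\<in>{e1, e2, e3}. card (?T e)) = 1" using e by simp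
    finally show ?thesis by simp
  qed
  have "{w \<in> E \<rightarrow>\<^sub>E V. R (w e1) (w e2) (w e3)} \<subseteq> (\<Union>t\<in>?Q. F t)"
  proof
    fix w assume w: "w \<in> {w \<in> E \<rightarrow>\<^sub>E V. R (w e1) (w e2) (w e3)}"
    then have "(w e1, w e2, w e3) \<in> ?Q" using e by (auto simp: PiE_iff)
    moreover have "w \<in> F (w e1, w e2, w e3)" using w by (auto simp: F_def PiE_iff)
    ultimately show "w \<in> (\<Union>t\<in>?Q. F t)" by blast
  qed
  moreover have "finite (F t)" for t
    using F[of t] fin unfolding F_def by (cases t) (auto intro!: finite_PiE)
  ultimately have "card {w \<in> E \<rightarrow>\<^sub>E V. R (w e1) (w e2) (w e3)} \<le> card (\<Union>t\<in>?Q. F t)"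
    using finQ by (intro card_mono) auto
  also have "\<dots> \<le> (\<Sum>t\<in>?Q. card (F t))" by (rule card_UN_le[OF finQ])
  also have "\<dots> = card ?Q * card V ^ card (E - {e1, e2, e3})" by (simp add: F)
  finally have "card {w \<in> E \<rightarrow>\<^sub>E V. R (w e1) (w e2) (w e3)} * card V ^ 3
    \<le> card ?Q * card V ^ card (E - {e1, e2, e3}) * card V ^ 3" by (rule mult_right_mono) simp
  also have "\<dots> = card ?Q * card (E \<rightarrow>\<^sub>E V)"
    using fin cardE by (simp add: card_PiE power_add mult.assoc)
  finally show ?thesis .
qed

text \<open>A discrete simplex with \<open>(D + 2) choose 3\<close> points; its layers are
  triangular numbers.\<close>

lemma card_simplex: "6 * card {(t, u, v). t + u + v < (D::nat)} = D * (D + 1) * (D + 2)"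
proof -
  have "{(t, u, v). t + u + v < D} = (SIGMA t:{..<D}. SIGMA u:{..<D - t}. {..<D - t - u})" by auto
  then have "card {(t, u, v). t + u + v < D} = (\<Sum>t<D. \<Sum>u<D - t. D - t - u)" by simp
  also have "\<dots> = (\<Sum>t<D. \<Sum>u<Suc t. Suc t - u)"
    by (subst sum.nat_diff_reindex[symmetric], intro sum.cong refl) (auto simp: Suc_diff_Suc)
  also have "6 * \<dots> = D * (D + 1) * (D + 2)"
  proof (induction D)
    case (Suc D)
    have s: "(\<Sum>u<Suc t. Suc t - u) = (\<Sum>u<Suc t. Suc u)" for t
      by (subst sum.nat_diff_reindex[symmetric], intro sum.cong refl) auto
    have "2 * (\<Sum>u<n. Suc u) = n * (n + 1)" for n by (induction n) auto
    from this[of "Suc D"] s[of D] have "2 * (\<Sum>u<Suc D. Suc D - u) = (D + 1) * (D + 2)" by simp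
    then have "6 * (\<Sum>u<Suc D. Suc D - u) = 3 * ((D + 1) * (D + 2))" by linarith
    with Suc show ?case by (simp add: algebra_simps)
  qed simp
  finally show ?thesis .
qed

text \<open>In the slacks \<open>t = L - x\<close>, \<open>u = y - m - 1\<close>,
  \<open>v = z - m - 1\<close> the condition reads \<open>t + u + v < L - 2 * m\<close>: the two
  units lost to the open lower end \<open>m\<close> absorb the margin 2.\<close>

lemma card_narrow_triples_le:
  fixes m L :: nat
  assumes "2 * m \<le> L"
  shows "6 * card {(x, y, z) \<in> {m<..L} \<times> {m<..L} \<times> {m<..L}. y + z < x + 2}
    \<le> (L - 2 * m) * (L - 2 * m + 1) * (L - 2 * m + 2)"
proof -
  let ?Q = "{(x, y, z) \<in> {m<..L} \<times> {m<..L} \<times> {m<..L}. y + z < x + 2}"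
  let ?S = "{(t, u, v). t + u + v < L - 2 * m}"
  have fin: "finite ?S"
    by (rule finite_subset[of _ "{..<L - 2*m} \<times> {..<L - 2*m} \<times> {..<L - 2*m}"]) auto
  have "card ?Q \<le> card ?S"
  proof (rule card_inj_on_le[OF _ _ fin])
    show "inj_on (\<lambda>(x, y, z). (L - x, y - m - 1, z - m - 1)) ?Q" by (auto simp: inj_on_def)
    show "(\<lambda>(x, y, z). (L - x, y - m - 1, z - m - 1)) ` ?Q \<subseteq> ?S" using assms by auto
  qed
  then show ?thesis unfolding card_simplex[symmetric] by simp
qed

text \<open>
  The margin 2 ensures that rounding within a grid cell cannot violate the triangle inequality.
\<close>

definition narrow :: "(nat set \<Rightarrow> nat) \<Rightarrow> nat set \<Rightarrow> bool" where
  "narrow w T \<longleftrightarrow> (\<exists>i j k. T = {i, j, k} \<and> i \<noteq> j \<and> i \<noteq> k \<and> j \<noteq> k \<and> w {i, k} + w {k, j} < w {i, j} + 2)"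

lemma narrow_cases:
  assumes "narrow w {a, b, c}" "a \<noteq> b" "a \<noteq> c" "b \<noteq> c"
  shows "w {a, c} + w {b, c} < w {a, b} + 2 \<or> w {a, b} + w {b, c} < w {a, c} + 2 \<or> w {a, b} + w {a, c} < w {b, c} + 2"
proof -
  obtain i j k where ijk: "{a, b, c} = {i, j, k}" "i \<noteq> j" "i \<noteq> k" "j \<noteq> k" "w {i, k} + w {k, j} < w {i, j} + 2"
    using assms(1) unfolding narrow_def by auto
  have k: "k \<in> {a, b, c}" unfolding ijk(1) by simp
  have ij: "{i, j} = {a, b, c} - {k}" using ijk by auto
  from k consider "k = a" | "k = b" | "k = c" by auto
  then show ?thesis
  proof cases
    case 1
    then have "{i, j} = {b, c}" using ij assms(2-4) by auto
    then have "i = b \<and> j = c \<or> i = c \<and> j = b" by (auto simp: doubleton_eq_iff)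
    then show ?thesis using ijk(5) 1 by (auto simp: insert_commute)
  next
    case 2
    then have "{i, j} = {a, c}" using ij assms(2-4) by auto
    then have "i = a \<and> j = c \<or> i = c \<and> j = a" by (auto simp: doubleton_eq_iff)
    then show ?thesis using ijk(5) 2 by (auto simp: insert_commute)
  next
    case 3
    then have "{i, j} = {a, b}" using ij assms(2-4) by auto
    then have "i = a \<and> j = b \<or> i = b \<and> j = a" by (auto simp: doubleton_eq_iff)
    then show ?thesis using ijk(5) 3 by (auto simp: insert_commute)
  qed
qed

lemma narrow_cong:
  assumes "\<And>e. e \<in> nsets T 2 \<Longrightarrow> w' e = w e"
  shows "narrow w' T \<longleftrightarrow> narrow w T"
proof -
  have "w' {i, j} = w {i, j}" if "i \<in> T" "j \<in> T" "i \<noteq> j" for i j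
    using that by (intro assms) simp
  then show ?thesis unfolding narrow_def by (intro ex_cong1 conj_cong refl) auto
qed

text \<open>A union bound over which of the three edges is the long one. Each choice contributes one
  sixth of the right-hand product, hence the factor \<open>2 = 6 / 3\<close>.\<close>

lemma card_narrow_le:
  assumes T: "T \<in> nsets {1..n} 3" and m: "2 * m \<le> L"
  shows "2 * (card {w \<in> nsets {1..n} 2 \<rightarrow>\<^sub>E {m<..L}. narrow w T} * (L - m) ^ 3)
    \<le> (L - 2 * m) * (L - 2 * m + 1) * (L - 2 * m + 2) * card (nsets {1..n} 2 \<rightarrow>\<^sub>E {m<..L})"
proof -
  let ?E = "nsets {1..n} 2" and ?V = "{m<..L}"
  let ?\<Omega> = "?E \<rightarrow>\<^sub>E ?V" and ?D = "(L - 2 * m) * (L - 2 * m + 1) * (L - 2 * m + 2)"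
  obtain a b c where abc: "T = {a, b, c}" "a \<noteq> b" "a \<noteq> c" "b \<noteq> c"
    using T unfolding nsets_def by (auto simp: card_3_iff)
  with T have mem: "a \<in> {1..n}" "b \<in> {1..n}" "c \<in> {1..n}" unfolding nsets_def by auto
  define C where "C e1 e2 e3 = {w \<in> ?\<Omega>. w e2 + w e3 < w e1 + 2}" for e1 e2 e3
  have fin: "finite ?E" "finite ?\<Omega>" using finite_pairs[of n] by (auto intro!: finite_PiE)
  have C: "6 * (card (C e1 e2 e3) * (L - m) ^ 3) \<le> ?D * card ?\<Omega>"
    if "e1 \<in> ?E" "e2 \<in> ?E" "e3 \<in> ?E" "e1 \<noteq> e2" "e1 \<noteq> e3" "e2 \<noteq> e3" for e1 e2 e3
  proof -
    have "card (C e1 e2 e3) * (L - m) ^ 3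
        \<le> card {(x, y, z) \<in> ?V \<times> ?V \<times> ?V. y + z < x + 2} * card ?\<Omega>"
      using card_PiE_three_coordinates_le[OF fin(1) _ that, of ?V "\<lambda>x y z. y + z < x + 2"] by (simp add: C_def)
    then have "6 * (card (C e1 e2 e3) * (L - m) ^ 3)
        \<le> 6 * card {(x, y, z) \<in> ?V \<times> ?V \<times> ?V. y + z < x + 2} * card ?\<Omega>" by simp
    also have "\<dots> \<le> ?D * card ?\<Omega>" using card_narrow_triples_le[OF m] by (rule mult_right_mono) simp
    finally show ?thesis .
  qed
  have E: "{a, b} \<in> ?E" "{a, c} \<in> ?E" "{b, c} \<in> ?E" using mem abc(2-4) by simp_all
  have ne: "{a, b} \<noteq> {a, c}" "{a, b} \<noteq> {b, c}" "{a, c} \<noteq> {b, c}"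
    using abc(2-4) by (auto simp: doubleton_eq_iff)
  note C1 = C[OF E ne] and C2 = C[OF E(2,1,3) ne(1)[symmetric] ne(3,2)]
    and C3 = C[OF E(3,1,2) ne(2)[symmetric] ne(3)[symmetric] ne(1)]
  have "{w \<in> ?\<Omega>. narrow w T} \<subseteq> C {a, b} {a, c} {b, c} \<union> C {a, c} {a, b} {b, c} \<union> C {b, c} {a, b} {a, c}"
    using narrow_cases abc unfolding C_def by blast
  then have "card {w \<in> ?\<Omega>. narrow w T} \<le> card (C {a, b} {a, c} {b, c} \<union> C {a, c} {a, b} {b, c} \<union> C {b, c} {a, b} {a, c})"
    using fin by (intro card_mono) (auto simp: C_def)
  also have "\<dots> \<le> card (C {a, b} {a, c} {b, c}) + card (C {a, c} {a, b} {b, c}) + card (C {b, c} {a, b} {a, c})"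
    by (meson add_le_mono card_Un_le le_refl order_trans)
  finally have "6 * (card {w \<in> ?\<Omega>. narrow w T} * (L - m) ^ 3)
      \<le> 6 * ((card (C {a, b} {a, c} {b, c}) + card (C {a, c} {a, b} {b, c}) + card (C {b, c} {a, b} {a, c})) * (L - m) ^ 3)"
    by (intro mult_left_mono mult_right_mono) auto
  also have "\<dots> = 6 * (card (C {a, b} {a, c} {b, c}) * (L - m) ^ 3) + 6 * (card (C {a, c} {a, b} {b, c}) * (L - m) ^ 3)
      + 6 * (card (C {b, c} {a, b} {a, c}) * (L - m) ^ 3)"
    by (simp only: distrib_left distrib_right)
  also have "\<dots> \<le> 3 * (?D * card ?\<Omega>)"
    using C1 C2 C3 by linarith
  finally show ?thesis by linarith
qed

text \<open>Such a triangle is one of the 3 edges of \<open>T\<close> plus a vertex.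
  \<open>T\<close> itself is among them, as the local lemma needs: its independence hypothesis must
  not involve the event \<open>T\<close>.\<close>

lemma card_adjacent_triangles_le:
  assumes "T \<in> nsets {1..n} 3"
  shows "card {T' \<in> nsets {1..n} 3. nsets T 2 \<inter> nsets T' 2 \<noteq> {}} \<le> 3 * n"
proof -
  have T: "finite T" "card T = 3" using assms by (auto simp: nsets_def)
  have "{T' \<in> nsets {1..n} 3. nsets T 2 \<inter> nsets T' 2 \<noteq> {}} \<subseteq> (\<lambda>(e, v). insert v e) ` (nsets T 2 \<times> {1..n})"
  proof
    fix T' assume T': "T' \<in> {T' \<in> nsets {1..n} 3. nsets T 2 \<inter> nsets T' 2 \<noteq> {}}"
    then obtain e where e: "e \<in> nsets T 2" "e \<in> nsets T' 2" by auto
    then have "card (T' - e) = 1" using T' by (subst card_Diff_subset) (auto simp: nsets_def)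
    then obtain v where v: "T' - e = {v}" by (auto simp: card_1_singleton_iff)
    then have "T' = insert v e" "v \<in> {1..n}" using e T' by (auto simp: nsets_def)
    with e show "T' \<in> (\<lambda>(e, v). insert v e) ` (nsets T 2 \<times> {1..n})" by force
  qed
  then have "card {T' \<in> nsets {1..n} 3. nsets T 2 \<inter> nsets T' 2 \<noteq> {}} \<le> card ((\<lambda>(e, v). insert v e) ` (nsets T 2 \<times> {1..n}))"
    using T by (intro card_mono) (auto intro: finite_imp_finite_nsets)
  also have "\<dots> \<le> card (nsets T 2 \<times> {1..n})"
    using T by (intro card_image_le) (auto intro: finite_imp_finite_nsets)
  also have "\<dots> = (3 choose 2) * n" using T(2) by (simp only: card_cartesian_product card_nsets) simp
  also have "\<dots> = 3 * n" by (simp add: choose_two)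
  finally show ?thesis .
qed

text \<open>The grid \<open>{(2 * r - 1) * r<..4 * r^2}\<close> discretises the interval
  \<open>(1 - 1 / (2 * r), 2]\<close> with mesh \<open>1 / (2 * r^2)\<close>.\<close>

lemma card_no_narrow_triangle_ge:
  fixes n r :: nat and p :: real
  assumes r: "1 \<le> r" and p: "(2 + 1 / r) * (2 + 2 / r) / (2 * r + 1) ^ 3 \<le> p" and np: "6 * n * p \<le> 1/2"
    and n: "1 \<le> n"
  shows "(1 - p / (1 - 6 * n * p)) ^ (n choose 3) * ((2 * r + 1) * r) ^ (n choose 2)
    \<le> card {w \<in> nsets {1..n} 2 \<rightarrow>\<^sub>E {(2 * r - 1) * r<..4 * r^2}. \<forall>T\<in>nsets {1..n} 3. \<not> narrow w T}"
proof -
  let ?E = "nsets {1..n} 2" and ?I = "nsets {1..n} 3"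
  define m L where "m = (2 * r - 1) * r" and "L = 4 * r^2"
  define \<Omega> where "\<Omega> = ?E \<rightarrow>\<^sub>E {m<..L}"
  define B where "B T = {w \<in> \<Omega>. narrow w T}" for T
  define \<Gamma> where "\<Gamma> T = {T' \<in> ?I. nsets T 2 \<inter> nsets T' 2 \<noteq> {}}" for T
  \<comment> \<open>Chosen so that the local lemma condition follows from Bernoulli's inequality:
    \<open>x \<le> 2 * p\<close> gives \<open>(1 - x) ^ (3 * n) \<ge> 1 - 6 * n * p\<close>, and
    \<open>x\<close> times the latter is \<open>p\<close>.\<close>
  define x where "x = p / (1 - 6 * n * p)"
  have diff: "L - 2 * m = 2 * r" "L - m = (2 * r + 1) * r" "2 * m \<le> L"
  proof -
    have "real m = (2 * real r - 1) * r" unfolding m_def using r by (simp add: of_nat_diff)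
    then have "real L = real (2 * m + 2 * r)" "real L = real (m + (2 * r + 1) * r)"
      by (simp_all add: L_def power2_eq_square algebra_simps)
    then have "L = 2 * m + 2 * r" "L = m + (2 * r + 1) * r" unfolding of_nat_eq_iff by auto
    then show "L - 2 * m = 2 * r" "L - m = (2 * r + 1) * r" "2 * m \<le> L" by linarith+
  qed
  have p0: "0 < p"
  proof -
    have "0 < (2 + 1 / r) * (2 + 2 / r) / (2 * r + 1) ^ 3" using r by (intro divide_pos_pos mult_pos_pos add_pos_nonneg) auto
    with p show ?thesis by linarith
  qed
  have fin: "finite \<Omega>" "finite ?I" unfolding \<Omega>_def
    using finite_pairs[of n] by (auto intro!: finite_PiE finite_imp_finite_nsets)
  have card\<Omega>: "card \<Omega> = ((2 * r + 1) * r) ^ (n choose 2)"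
    unfolding \<Omega>_def using finite_pairs[of n] diff by (simp add: card_PiE card_nsets)
  have xp: "0 \<le> x" "x \<le> 2 * p"
    using p0 np by (auto simp: x_def pos_divide_le_eq algebra_simps)
  have "1 * p \<le> n * p" using n p0 by (intro mult_right_mono) auto
  then have x1: "x < 1" using np xp by simp
  have px: "p \<le> x * (1 - x) ^ (3 * n)"
  proof -
    have "1 - 6 * n * p \<le> 1 - 3 * n * x"
      using mult_left_mono[OF xp(2), of "3 * real n"] by simp
    also have "\<dots> \<le> (1 - x) ^ (3 * n)" using Bernoulli_inequality[of "- x" "3 * n"] x1 by simp
    finally have "x * (1 - 6 * n * p) \<le> x * (1 - x) ^ (3 * n)" using xp by (intro mult_left_mono) auto
    moreover have "x * (1 - 6 * n * p) = p" using np by (simp add: x_def)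
    ultimately show ?thesis by simp
  qed
  have nbr: "card (\<Gamma> T) \<le> 3 * n \<and> finite (\<Gamma> T)" if "T \<in> ?I" for T
    using card_adjacent_triangles_le[OF that] fin unfolding \<Gamma>_def by auto
  have cardB: "real (card (B T)) \<le> p * card \<Omega>" if "T \<in> ?I" for T
  proof -
    let ?W = "(2 * real r + 1) * r"
    have W: "?W > 0" using r by simp
    have "2 * (card (B T) * ((2 * r + 1) * r) ^ 3) \<le> 2 * r * (2 * r + 1) * (2 * r + 2) * card \<Omega>"
      using card_narrow_le[OF that diff(3)] unfolding diff B_def \<Omega>_def by simp
    then have "card (B T) * ((2 * r + 1) * r) ^ 3 \<le> r * (2 * r + 1) * (2 * r + 2) * card \<Omega>"
      by (simp only: mult.assoc mult_le_cancel1 zero_less_numeral simp_thms)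
    then have "real (card (B T) * ((2 * r + 1) * r) ^ 3) \<le> real (r * (2 * r + 1) * (2 * r + 2) * card \<Omega>)"
      by (rule of_nat_mono)
    then have "card (B T) * ?W ^ 3 \<le> r * (2 * real r + 1) * (2 * r + 2) * card \<Omega>"
      by (simp only: of_nat_mult of_nat_power of_nat_add of_nat_numeral of_nat_1)
    then have "real (card (B T)) \<le> (r * (2 * real r + 1) * (2 * r + 2) * card \<Omega>) / ?W ^ 3"
      using W by (simp add: pos_le_divide_eq)
    also have "\<dots> = (2 + 1 / r) * (2 + 2 / r) / (2 * r + 1) ^ 3 * card \<Omega>"
    proof -
      have "(2 + 1 / r) * (2 + 2 / r) / (2 * r + 1) ^ 3 = (2 + 1 / r) * (2 + 2 / r) * real r ^ 3 / ?W ^ 3"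
        using r by (simp add: power_mult_distrib add.commute)
      also have "(2 + 1 / r) * (2 + 2 / r) * real r ^ 3 = r * (2 * real r + 1) * (2 * r + 2)"
        using r by (simp add: field_simps power3_eq_cube)
      finally show ?thesis by simp
    qed
    also have "\<dots> \<le> p * card \<Omega>" using p by (intro mult_right_mono) auto
    finally show ?thesis .
  qed
  have indep: "real (card (B T \<inter> {w\<in>\<Omega>. \<forall>T'\<in>S. w \<notin> B T'})) \<le> p * card {w\<in>\<Omega>. \<forall>T'\<in>S. w \<notin> B T'}"
    if T: "T \<in> ?I" "S \<subseteq> ?I - \<Gamma> T" for T S
  proof -
    let ?G = "{w\<in>\<Omega>. \<forall>T'\<in>S. w \<notin> B T'}"
    have "card (B T \<inter> ?G) * card (?E \<rightarrow>\<^sub>E {m<..L}) = card (B T) * card ?G"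
    proof (rule card_Int_PiE_independent[where S = "nsets T 2"])
      show "B T \<subseteq> ?E \<rightarrow>\<^sub>E {m<..L}" "?G \<subseteq> ?E \<rightarrow>\<^sub>E {m<..L}" by (auto simp: B_def \<Omega>_def)
    next
      fix w w' assume "w \<in> B T" "w' \<in> ?E \<rightarrow>\<^sub>E {m<..L}" "\<And>e. e \<in> nsets T 2 \<Longrightarrow> w' e = w e"
      then show "w' \<in> B T" using narrow_cong[of T w' w] by (simp add: B_def \<Omega>_def)
    next
      fix w w' assume w: "w \<in> ?G" "w' \<in> ?E \<rightarrow>\<^sub>E {m<..L}" "\<And>e. e \<notin> nsets T 2 \<Longrightarrow> w' e = w e"
      have "w' \<notin> B T'" if "T' \<in> S" for T'
      proof -
        have "nsets T 2 \<inter> nsets T' 2 = {}" using T(2) that by (auto simp: \<Gamma>_def)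
        then have "narrow w' T' \<longleftrightarrow> narrow w T'" using w(3) by (intro narrow_cong) auto
        then show ?thesis using w(1) that by (simp add: B_def)
      qed
      then show "w' \<in> ?G" using w(2) by (simp add: \<Omega>_def)
    qed
    then have "real (card (B T \<inter> ?G)) * card \<Omega> = real (card (B T)) * card ?G"
      unfolding \<Omega>_def[symmetric] of_nat_mult[symmetric] of_nat_eq_iff .
    also have "\<dots> \<le> p * card \<Omega> * card ?G" using cardB[OF T(1)] by (intro mult_right_mono) auto
    finally have "real (card (B T \<inter> ?G)) * card \<Omega> \<le> (p * card ?G) * card \<Omega>" by (simp add: mult_ac)
    moreover have "card \<Omega> > 0" unfolding card\<Omega> using r by simp
    ultimately show ?thesis by simp
  qed
  have "(1 - x) ^ card ?I * card \<Omega> \<le> card {w\<in>\<Omega>. \<forall>T\<in>?I. w \<notin> B T}"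
    by (rule local_lemma_counting[OF fin xp(1) x1 nbr px indep])
  moreover have "{w\<in>\<Omega>. \<forall>T\<in>?I. w \<notin> B T} = {w\<in>\<Omega>. \<forall>T\<in>?I. \<not> narrow w T}" by (auto simp: B_def)
  ultimately show ?thesis
    unfolding card\<Omega> by (simp add: card_nsets x_def \<Omega>_def m_def L_def)
qed

subsection \<open>Volumes\<close>

text \<open>Cells open at the left match rounding up: they are disjoint, and values
  \<open>{1..2*N}\<close> tile \<open>(0, 2]\<close> in each coordinate.\<close>

definition cell :: "nat \<Rightarrow> nat \<Rightarrow> (nat set \<Rightarrow> nat) \<Rightarrow> (nat set \<Rightarrow> real) set" where
  "cell N n w = (\<Pi>\<^sub>E e\<in>nsets {1..n} 2. {(real (w e) - 1) / N<..real (w e) / N})"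

lemma cell_sets: "cell N n w \<in> sets (pair_lebesgue n)"
  unfolding cell_def pair_lebesgue_def using finite_pairs[of n] by (intro sets_PiM_I_finite) auto

lemma emeasure_cell:
  assumes "N \<ge> 1"
  shows "emeasure (pair_lebesgue n) (cell N n w) = ennreal ((1 / N) ^ (n choose 2))"
proof -
  interpret product_sigma_finite "\<lambda>_::nat set. lborel :: real measure" ..
  have "emeasure (pair_lebesgue n) (cell N n w)
      = (\<Prod>e\<in>nsets {1..n} 2. emeasure lborel {(real (w e) - 1) / N<..real (w e) / N})"
    unfolding cell_def pair_lebesgue_def using finite_pairs[of n] by (intro emeasure_PiM) auto
  also have "\<dots> = (\<Prod>e\<in>nsets {1..n} 2. ennreal (1 / N))"
  proof (rule prod.cong)
    fix e
    have "(real (w e) - 1) / N \<le> real (w e) / N" by (intro divide_right_mono) auto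
    then show "emeasure lborel {(real (w e) - 1) / N<..real (w e) / N} = ennreal (1 / N)"
      by (simp add: diff_divide_distrib)
  qed simp
  also have "\<dots> = ennreal ((1 / N) ^ (n choose 2))"
    by (simp add: card_pairs ennreal_power)
  finally show ?thesis .
qed

lemma cell_disjoint:
  assumes "N \<ge> 1" and w: "w \<in> nsets {1..n} 2 \<rightarrow>\<^sub>E A" "w' \<in> nsets {1..n} 2 \<rightarrow>\<^sub>E B"
    and d: "d \<in> cell N n w" "d \<in> cell N n w'"
  shows "w = w'"
proof (rule PiE_ext[where k = "nsets {1..n} 2" and s = "\<lambda>_. UNIV"])
  fix e assume e: "e \<in> nsets {1..n} 2"
  have "(real (w e) - 1) / N < d e" "d e \<le> real (w e) / N" "(real (w' e) - 1) / N < d e" "d e \<le> real (w' e) / N"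
    using d e by (auto simp: cell_def PiE_iff)
  then have "real (w e) - 1 < d e * N" "d e * N \<le> real (w e)" "real (w' e) - 1 < d e * N" "d e * N \<le> real (w' e)"
    using assms(1) by (simp_all add: pos_divide_less_eq pos_le_divide_eq)
  then show "w e = w' e" by linarith
qed (use w in \<open>auto simp: PiE_iff\<close>)

lemma emeasure_cells:
  assumes N: "N \<ge> 1" and W: "finite W" "W \<subseteq> nsets {1..n} 2 \<rightarrow>\<^sub>E A"
  shows "emeasure (pair_lebesgue n) (\<Union>w\<in>W. cell N n w) = ennreal (card W * (1 / N) ^ (n choose 2))"
proof -
  have "disjoint_family_on (cell N n) W"
    unfolding disjoint_family_on_def using cell_disjoint[OF N] W(2) by blast
  then have "emeasure (pair_lebesgue n) (\<Union>w\<in>W. cell N n w) = (\<Sum>w\<in>W. emeasure (pair_lebesgue n) (cell N n w))"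
    using W(1) cell_sets by (intro sum_emeasure[symmetric]) auto
  then show ?thesis by (simp add: emeasure_cell[OF N] ennreal_mult' ennreal_of_nat_eq_real_of_nat)
qed

lemma measure_cells:
  assumes "N \<ge> 1" and "finite W" "W \<subseteq> nsets {1..n} 2 \<rightarrow>\<^sub>E A"
  shows "measure (pair_lebesgue n) (\<Union>w\<in>W. cell N n w) = card W / real N ^ (n choose 2)"
  using emeasure_cells[OF assms] by (simp add: measure_def power_divide)

text \<open>Rounding up is subadditive, so it preserves the triangle inequality and the cells of the
  integer metrics cover the polytope.\<close>

lemma measure_polytope_le:
  assumes N: "N \<ge> 1"
  shows "measure (pair_lebesgue n) (metric_polytope n) \<le> card (int_metrics N n) / real N ^ (n choose 2)"
proof -
  let ?E = "nsets {1..n} 2"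
  have sub: "int_metrics N n \<subseteq> ?E \<rightarrow>\<^sub>E {1..2*N}" by (auto simp: int_metrics_def)
  have "metric_polytope n \<subseteq> (\<Union>w\<in>int_metrics N n. cell N n w)"
  proof
    fix d assume d: "d \<in> metric_polytope n"
    define w where "w = (\<lambda>e\<in>?E. nat \<lceil>N * d e\<rceil>)"
    have d02: "0 < d e" "d e \<le> 2" if "e \<in> ?E" for e using d that by (auto simp: metric_polytope_def)
    have w: "real (w e) - 1 < N * d e" "N * d e \<le> w e" if "e \<in> ?E" for e
    proof -
      have "0 < N * d e" using d02[OF that] N by simp
      then have "real (w e) = \<lceil>N * d e\<rceil>" using that by (simp add: w_def)
      then show "real (w e) - 1 < N * d e" "N * d e \<le> w e" by linarith+
    qed
    have "w e \<in> {1..2*N}" if "e \<in> ?E" for e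
    proof -
      have "0 < N * d e" "N * d e \<le> N * 2" using d02[OF that] N by auto
      with w[OF that] have "0 < real (w e)" "real (w e) < real (2 * N + 1)" by linarith+
      then show ?thesis by auto
    qed
    moreover have "w {i, j} \<le> w {i, k} + w {k, j}"
      if "i \<in> {1..n}" "j \<in> {1..n}" "k \<in> {1..n}" "i \<noteq> j" "i \<noteq> k" "j \<noteq> k" for i j k
    proof -
      have E: "{i, j} \<in> ?E" "{i, k} \<in> ?E" "{k, j} \<in> ?E" using that by auto
      have "d {i, j} \<le> d {i, k} + d {k, j}" using d that by (auto simp: metric_polytope_def)
      then have "N * d {i, j} \<le> N * (d {i, k} + d {k, j})" by (rule mult_left_mono) simp
      then have "real (w {i, j}) < real (w {i, k} + w {k, j} + 1)"
        using w[OF E(1)] w[OF E(2)] w[OF E(3)] by (simp add: distrib_left)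
      then show ?thesis by simp
    qed
    ultimately have "w \<in> int_metrics N n" unfolding int_metrics_def by (auto simp: w_def)
    moreover have "d \<in> cell N n w"
      using d w N by (auto simp: cell_def PiE_iff metric_polytope_def pos_divide_less_eq pos_le_divide_eq mult.commute)
    ultimately show "d \<in> (\<Union>w\<in>int_metrics N n. cell N n w)" by blast
  qed
  then have "measure (pair_lebesgue n) (metric_polytope n) \<le> measure (pair_lebesgue n) (\<Union>w\<in>int_metrics N n. cell N n w)"
    using metric_polytope_measurable cell_sets emeasure_cells[OF N finite_int_metrics sub]
    by (intro measure_mono_fmeasurable fmeasurableI sets.finite_UN finite_int_metrics) auto
  also have "\<dots> = card (int_metrics N n) / real N ^ (n choose 2)"
    by (rule measure_cells[OF N finite_int_metrics sub])
  finally show ?thesis .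
qed

lemma cells_subset_polytope:
  assumes w: "w \<in> nsets {1..n} 2 \<rightarrow>\<^sub>E {1..2*N}" and N: "N \<ge> 1" and wide: "\<forall>T\<in>nsets {1..n} 3. \<not> narrow w T"
  shows "cell N n w \<subseteq> metric_polytope n"
proof
  let ?E = "nsets {1..n} 2"
  fix d assume d: "d \<in> cell N n w"
  have dw: "real (w e) - 1 < N * d e" "N * d e \<le> w e" "1 \<le> w e" "w e \<le> 2 * N" if "e \<in> ?E" for e
    using d w N that by (auto simp: cell_def PiE_iff pos_divide_less_eq pos_le_divide_eq mult.commute)
  have "0 < d e" "d e \<le> 2" if "e \<in> ?E" for e
  proof -
    have "real (w e) \<ge> 1" "real (w e) \<le> 2 * real N" using dw(3,4)[OF that] by linarith+
    then have "0 < N * d e" "N * d e \<le> N * 2" using dw(1,2)[OF that] by linarith+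
    then show "0 < d e" "d e \<le> 2" using N by (simp_all add: zero_less_mult_iff)
  qed
  moreover have "d {i, j} \<le> d {i, k} + d {k, j}"
    if "i \<in> {1..n}" "j \<in> {1..n}" "k \<in> {1..n}" "i \<noteq> j" "i \<noteq> k" "j \<noteq> k" for i j k
  proof -
    have E: "{i, j} \<in> ?E" "{i, k} \<in> ?E" "{k, j} \<in> ?E" using that by auto
    have "{i, j, k} \<in> nsets {1..n} 3" using that by (simp add: nsets_def)
    then have "\<not> narrow w {i, j, k}" using wide by blast
    moreover have "narrow w {i, j, k}" if "w {i, k} + w {k, j} < w {i, j} + 2"
      using that \<open>i \<noteq> j\<close> \<open>i \<noteq> k\<close> \<open>j \<noteq> k\<close> unfolding narrow_def by blast
    ultimately have "w {i, j} + 2 \<le> w {i, k} + w {k, j}" by linarith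
    then have "real (w {i, j}) + 2 \<le> real (w {i, k}) + real (w {k, j})" by linarith
    \<comment> \<open>Each summand on the right lies less than 1 below its integer value, and the
      left side does not exceed its own.\<close>
    then have "N * d {i, j} \<le> N * d {i, k} + N * d {k, j}"
      using dw(2)[OF E(1)] dw(1)[OF E(2)] dw(1)[OF E(3)] by linarith
    then have "N * d {i, j} \<le> N * (d {i, k} + d {k, j})" by (simp add: distrib_left)
    then show ?thesis using N by simp
  qed
  moreover have "d \<in> ?E \<rightarrow>\<^sub>E UNIV" using d by (auto simp: cell_def PiE_iff)
  ultimately show "d \<in> metric_polytope n" by (auto simp: metric_polytope_def)
qed

text \<open>With mesh \<open>1 / N\<close>, \<open>N = 2 * r^2\<close>, the
  \<open>(2 * r + 1) * r\<close> grid values per edge amount to length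
  \<open>1 + 1 / (2 * r)\<close>, which turns the count into a volume.\<close>

lemma measure_polytope_ge:
  fixes n r :: nat and p :: real
  assumes r: "1 \<le> r" and p: "(2 + 1 / r) * (2 + 2 / r) / (2 * r + 1) ^ 3 \<le> p" and np: "6 * n * p \<le> 1/2"
    and n: "1 \<le> n"
  shows "(1 - p / (1 - 6 * n * p)) ^ (n choose 3) * (1 + 1 / (2 * real r)) ^ (n choose 2)
    \<le> measure (pair_lebesgue n) (metric_polytope n)"
proof -
  let ?E = "nsets {1..n} 2"
  define N where "N = 2 * r^2"
  define W where "W = {w \<in> ?E \<rightarrow>\<^sub>E {(2 * r - 1) * r<..4 * r^2}. \<forall>T\<in>nsets {1..n} 3. \<not> narrow w T}"
  have N: "N \<ge> 1" using r by (simp add: N_def)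
  have fin: "finite W" unfolding W_def using finite_pairs[of n] by (auto intro!: finite_PiE)
  have "W \<subseteq> ?E \<rightarrow>\<^sub>E {(2 * r - 1) * r<..4 * r^2}" by (auto simp: W_def)
  moreover have "?E \<rightarrow>\<^sub>E {(2 * r - 1) * r<..4 * r^2} \<subseteq> ?E \<rightarrow>\<^sub>E {1..2*N}"
    by (rule PiE_mono) (auto simp: N_def)
  ultimately have W: "W \<subseteq> ?E \<rightarrow>\<^sub>E {1..2*N}" by blast
  have q: "real ((2 * r + 1) * r) ^ (n choose 2) = (1 + 1 / (2 * real r)) ^ (n choose 2) * real N ^ (n choose 2)"
  proof -
    have "real ((2 * r + 1) * r) = (1 + 1 / (2 * real r)) * real N"
      using r by (simp add: N_def power2_eq_square field_simps)
    then show ?thesis by (simp only: power_mult_distrib)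
  qed
  have "(1 - p / (1 - 6 * n * p)) ^ (n choose 3) * real ((2 * r + 1) * r) ^ (n choose 2) \<le> card W"
    using card_no_narrow_triangle_ge[OF assms] unfolding W_def by simp
  then have "(1 - p / (1 - 6 * n * p)) ^ (n choose 3) * (1 + 1 / (2 * real r)) ^ (n choose 2) \<le> card W / real N ^ (n choose 2)"
    unfolding q using N by (simp add: pos_le_divide_eq mult.assoc)
  also have "\<dots> = measure (pair_lebesgue n) (\<Union>w\<in>W. cell N n w)"
    by (rule measure_cells[OF N fin W, symmetric])
  also have "\<dots> \<le> measure (pair_lebesgue n) (metric_polytope n)"
  proof (rule measure_mono_fmeasurable)
    show "(\<Union>w\<in>W. cell N n w) \<subseteq> metric_polytope n"
    proof (rule UN_least)
      fix w assume "w \<in> W"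
      then show "cell N n w \<subseteq> metric_polytope n"
        by (intro cells_subset_polytope[OF subsetD[OF W] N]) (simp_all add: W_def)
    qed
    show "metric_polytope n \<in> fmeasurable (pair_lebesgue n)"
      using metric_polytope_measurable metric_polytope_finite by (intro fmeasurableI)
  qed (use fin cell_sets in auto)
  finally show ?thesis .
qed

section \<open>Asymptotics of the lower exponent\<close>

definition triangle_prob :: "real \<Rightarrow> real" where
  "triangle_prob s = (2 + 1 / s) * (2 + 2 / s) / (2 * s + 1) ^ 3"

text \<open>A lower bound for the logarithm in \<open>measure_polytope_ge\<close> at
  \<open>r = \<lceil>sqrt n\<rceil>\<close>, freed of rounding: \<open>r\<close> is replaced by
  \<open>sqrt n + 1\<close> in the volume factor and by \<open>sqrt n\<close> in the probability,
  and \<open>n choose 3\<close> by \<open>n ^ 3 / 6\<close>.\<close>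

definition log_lower :: "nat \<Rightarrow> real" where
  "log_lower n = (let p = triangle_prob (sqrt n) in
     real n * (real n - 1) / 2 * ln (1 + 1 / (2 * (sqrt n + 1))) + real n ^ 3 / 6 * ln (1 - p / (1 - 6 * n * p)))"

lemma log_lower_le:
  assumes n: "1 \<le> n" and np: "6 * n * triangle_prob (sqrt n) \<le> 1/2"
  shows "exp (log_lower n) \<le> measure (pair_lebesgue n) (metric_polytope n)"
proof -
  define s where "s = sqrt n"
  define r where "r = nat \<lceil>s\<rceil>"
  define p where "p = triangle_prob s"
  define x where "x = p / (1 - 6 * n * p)"
  have s: "1 \<le> s" using n by (simp add: s_def)
  have rs: "s \<le> r" "r \<le> s + 1" using s by (auto simp: r_def)
  have r: "1 \<le> r" using rs s by linarith
  have p0: "0 < p" using s unfolding p_def triangle_prob_def by (intro divide_pos_pos mult_pos_pos add_pos_nonneg) auto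
  have np': "6 * n * p \<le> 1/2" using np by (simp add: p_def s_def)
  have "(2 + 1 / r) * (2 + 2 / r) / (2 * r + 1) ^ 3 \<le> (2 + 1 / s) * (2 + 2 / s) / (2 * s + 1) ^ 3"
  proof (rule frac_le)
    show "(2 + 1 / r) * (2 + 2 / r) \<le> (2 + 1 / s) * (2 + 2 / s)"
      using rs s by (intro mult_mono add_left_mono divide_left_mono) auto
    show "(2 * s + 1) ^ 3 \<le> real ((2 * r + 1) ^ 3)"
    proof -
      have "(2 * s + 1) ^ 3 \<le> (2 * real r + 1) ^ 3" using rs s by (intro power_mono) auto
      then show ?thesis by (simp add: add.commute)
    qed
  qed (use s in auto)
  then have "(2 + 1 / r) * (2 + 2 / r) / (2 * r + 1) ^ 3 \<le> p" by (simp add: p_def triangle_prob_def)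
  from measure_polytope_ge[OF r this np' n]
  have M: "(1 - x) ^ (n choose 3) * (1 + 1 / (2 * real r)) ^ (n choose 2) \<le> measure (pair_lebesgue n) (metric_polytope n)"
    by (simp add: x_def)
  have "1 * p \<le> n * p" using n p0 by (intro mult_right_mono) auto
  then have "0 < 1 - 6 * n * p" "p < 1 - 6 * n * p" using p0 np' by linarith+
  then have x: "0 \<le> x" "x < 1" using p0 by (simp_all add: x_def pos_divide_less_eq)
  have "real (n choose 3) \<le> real n ^ 3 / 6"
  proof -
    have "real ((n choose 3) * fact 3) \<le> real (n ^ 3)" by (intro of_nat_mono binomial_fact_pow)
    then show ?thesis by (simp add: fact_numeral)
  qed
  \<comment> \<open>The logarithm is nonpositive, so an upper bound on the number of triangles is
    the right direction.\<close>
  then have 1: "real n ^ 3 / 6 * ln (1 - x) \<le> real (n choose 3) * ln (1 - x)"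
    using x by (intro mult_right_mono_neg) auto
  have c2: "real (n choose 2) = real n * (real n - 1) / 2"
  proof -
    have "2 * (n choose 2) = n * (n - 1)"
      unfolding choose_two by (rule dvd_mult_div_cancel) (use n in auto)
    then have "real (2 * (n choose 2)) = real (n * (n - 1))" by simp
    then show ?thesis using n by (simp add: of_nat_diff)
  qed
  have "ln (1 + 1 / (2 * (s + 1))) \<le> ln (1 + 1 / (2 * real r))"
    using rs s r by (intro ln_mono add_left_mono divide_left_mono) (auto intro: add_pos_nonneg)
  then have 2: "real n * (real n - 1) / 2 * ln (1 + 1 / (2 * (s + 1))) \<le> real (n choose 2) * ln (1 + 1 / (2 * real r))"
    unfolding c2[symmetric] by (intro mult_left_mono) auto
  have "exp (log_lower n) \<le> exp (real (n choose 2) * ln (1 + 1 / (2 * real r)) + real (n choose 3) * ln (1 - x))"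
    using 1 2 by (simp add: log_lower_def Let_def p_def s_def x_def)
  also have "\<dots> = (1 + 1 / (2 * real r)) ^ (n choose 2) * (1 - x) ^ (n choose 3)"
    using x r by (simp add: exp_add exp_of_nat_mult add_pos_nonneg)
  finally show ?thesis using M by (simp add: mult.commute)
qed

text \<open>The volume term is asymptotic to \<open>n^2 / 2 * 1 / (2 * sqrt n)\<close>. Since
  \<open>p\<close> is asymptotic to \<open>1 / (2 * n powr (3/2))\<close> and
  \<open>6 * n * p\<close> vanishes, the triangle term is asymptotic to
  \<open>- n powr (3/2) / 12\<close>.\<close>

lemma log_lower_asymptotics: "(\<lambda>n. log_lower n / real n powr (3/2)) \<longlonglongrightarrow> 1/6"
  unfolding log_lower_def triangle_prob_def Let_def by real_asymp

theorem theorem1p2: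
  shows "\<exists>(C :: real) (\<eta> :: nat \<Rightarrow> real). \<eta> \<longlonglongrightarrow> 0 \<and>
    (\<forall>\<^sub>F n in sequentially.
       exp ((1/6 - \<eta> n) * real n powr (3/2)) \<le> measure (pair_lebesgue n) (metric_polytope n) \<and>
       measure (pair_lebesgue n) (metric_polytope n) \<le> exp (C * real n powr (3/2)))"
proof (intro exI conjI)
  \<comment> \<open>For \<open>n \<ge> 1\<close> this choice makes the lower exponent equal to
    \<open>log_lower n\<close>.\<close>
  let ?\<eta> = "\<lambda>n. 1/6 - log_lower n / real n powr (3/2)"
  show "?\<eta> \<longlonglongrightarrow> 0"
    using tendsto_diff[OF tendsto_const log_lower_asymptotics, of "1/6"] by simp
  have "(\<lambda>n. 6 * real n * triangle_prob (sqrt n)) \<longlonglongrightarrow> 0"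
    unfolding triangle_prob_def by real_asymp
  then have small: "\<forall>\<^sub>F n in sequentially. 6 * real n * triangle_prob (sqrt n) < 1/2"
    by (rule order_tendstoD) simp
  show "\<forall>\<^sub>F n in sequentially.
       exp ((1/6 - ?\<eta> n) * real n powr (3/2)) \<le> measure (pair_lebesgue n) (metric_polytope n) \<and>
       measure (pair_lebesgue n) (metric_polytope n) \<le> exp (200 * real n powr (3/2))"
    using small eventually_ge_at_top[of 1]
  proof eventually_elim
    case (elim n)
    have "exp ((1/6 - ?\<eta> n) * real n powr (3/2)) = exp (log_lower n)" using elim by simp
    moreover have "exp (log_lower n) \<le> measure (pair_lebesgue n) (metric_polytope n)"
      using elim by (intro log_lower_le) auto
    moreover have "measure (pair_lebesgue n) (metric_polytope n) \<le> exp (200 * real n powr (3/2))"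
    proof -
      \<comment> \<open>At mesh \<open>1 / n\<close> the cell volume cancels the leading term
        \<open>(n choose 2) * ln n\<close> of the count exactly.\<close>
      let ?c = "card (int_metrics n n)"
      have c: "?c > 0" using int_metrics_nonempty[of n n] finite_int_metrics elim by (simp add: card_gt_0_iff)
      have "real n powr (3/2) = real n powr (1 + 1/2)" by simp
      also have "\<dots> = n * sqrt n" unfolding powr_add using elim by (simp add: powr_half_sqrt)
      finally have pw: "real n powr (3/2) = n * sqrt n" .
      have "real ?c = exp (ln ?c)" using c by simp
      also have "\<dots> \<le> exp (real (n choose 2) * ln n + 200 * real n * sqrt n)"
        using ln_card_int_metrics_le[of n n] elim by simp
      also have "\<dots> = real n ^ (n choose 2) * exp (200 * real n powr (3/2))"
        using elim by (simp add: exp_add exp_of_nat_mult pw mult.assoc)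
      finally have "?c / real n ^ (n choose 2) \<le> exp (200 * real n powr (3/2))"
        using elim by (simp add: pos_divide_le_eq mult.commute)
      then show ?thesis using measure_polytope_le[of n n] elim by simp
    qed
    ultimately show ?case by simp
  qed
qed

end
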